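(* Let $A_5$ be the alternating group of degree 5. The following d-identities form a basis of d-identities of $A_5$; that is, each of them holds in $A_5$, and every group in which all of them hold is isomorphic to a section (a quotient of a subgroup) of $A_5$: (1) $\omega_{60}=\bigvee_{0\le i<j\le 60}(x_i=x_j)$; (2) $(x^2=1)\vee(x^3=1)\vee(x^5=1)$; (3) in variables $x_1,x_2,x_3$: $\Big[\bigvee_{i=1}^{3} x_i^{15}=1\Big]\vee\Big[\bigvee_{1\le i<j\le 3}(x_ix_j)^{15}=1\Big]\vee\Big[\bigvee_{(i,j,k)} x_1^{i}x_2^{j}x_3^{k}=1\Big]$, where the last disjunction runs over all nonzero vectors $(i,j,k)\in\{0,1\}^3$; (4) $(x_1^{10}=1)\vee(x_2^{10}=1)\vee(x_1=x_2)\vee((x_1x_2)^{10}=1)\vee((x_1^2x_2)^2=1)$; (5) $(x_1^6=1)\vee(x_2^6=1)\vee\bigvee_{d=1}^{4}\big((x_1x_2^d)^6=1\big)$.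
   Context: A d-identity (disjunctive identity) is a universally quantified formula $\forall x_1\dots x_k\,[(f_1=1)\vee\dots\vee(f_n=1)]$, where the $f_i$ are words in the free group on $x_1,\dots,x_k$; an equation $u=v$ abbreviates $uv^{-1}=1$. A group satisfies a d-identity if the formula is true for every assignment of group elements to the variables. For a group $G$, $\mathrm{dvar}(G)$ is the class of all groups satisfying every d-identity satisfied by $G$; for finite $G$ this is exactly the class of groups isomorphic to sections (quotients of subgroups) of $G$. A set $\Sigma$ of d-identities is a basis of d-identities of $G$ if every member of $\Sigma$ holds in $G$ and every group satisfying all members of $\Sigma$ lies in $\mathrm{dvar}(G)$. *)

theory Defs
  imports "HOL-Algebra.Sym_Groups" "HOL-Algebra.Coset"
begin

definition dident1 :: "('a, 'b) monoid_scheme \<Rightarrow> bool" where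
  "dident1 G \<longleftrightarrow> (\<forall>x :: nat \<Rightarrow> 'a. (\<forall>i\<le>60. x i \<in> carrier G) \<longrightarrow>
      (\<exists>i j. i < j \<and> j \<le> 60 \<and> x i = x j))"

definition dident2 :: "('a, 'b) monoid_scheme \<Rightarrow> bool" where
  "dident2 G \<longleftrightarrow> (\<forall>x\<in>carrier G.
      x [^]\<^bsub>G\<^esub> (2::nat) = \<one>\<^bsub>G\<^esub> \<or> x [^]\<^bsub>G\<^esub> (3::nat) = \<one>\<^bsub>G\<^esub> \<or>
      x [^]\<^bsub>G\<^esub> (5::nat) = \<one>\<^bsub>G\<^esub>)"

definition dident3 :: "('a, 'b) monoid_scheme \<Rightarrow> bool" where
  "dident3 G \<longleftrightarrow> (\<forall>x1\<in>carrier G. \<forall>x2\<in>carrier G. \<forall>x3\<in>carrier G.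
      x1 [^]\<^bsub>G\<^esub> (15::nat) = \<one>\<^bsub>G\<^esub> \<or> x2 [^]\<^bsub>G\<^esub> (15::nat) = \<one>\<^bsub>G\<^esub> \<or>
      x3 [^]\<^bsub>G\<^esub> (15::nat) = \<one>\<^bsub>G\<^esub> \<or>
      (x1 \<otimes>\<^bsub>G\<^esub> x2) [^]\<^bsub>G\<^esub> (15::nat) = \<one>\<^bsub>G\<^esub> \<or>
      (x1 \<otimes>\<^bsub>G\<^esub> x3) [^]\<^bsub>G\<^esub> (15::nat) = \<one>\<^bsub>G\<^esub> \<or>
      (x2 \<otimes>\<^bsub>G\<^esub> x3) [^]\<^bsub>G\<^esub> (15::nat) = \<one>\<^bsub>G\<^esub> \<or>
      (\<exists>i\<in>{0::nat,1}. \<exists>j\<in>{0::nat,1}. \<exists>k\<in>{0::nat,1}. (i, j, k) \<noteq> (0, 0, 0) \<and>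
          x1 [^]\<^bsub>G\<^esub> i \<otimes>\<^bsub>G\<^esub> x2 [^]\<^bsub>G\<^esub> j \<otimes>\<^bsub>G\<^esub> x3 [^]\<^bsub>G\<^esub> k = \<one>\<^bsub>G\<^esub>))"

definition dident4 :: "('a, 'b) monoid_scheme \<Rightarrow> bool" where
  "dident4 G \<longleftrightarrow> (\<forall>x1\<in>carrier G. \<forall>x2\<in>carrier G.
      x1 [^]\<^bsub>G\<^esub> (10::nat) = \<one>\<^bsub>G\<^esub> \<or> x2 [^]\<^bsub>G\<^esub> (10::nat) = \<one>\<^bsub>G\<^esub> \<or>
      x1 = x2 \<or> (x1 \<otimes>\<^bsub>G\<^esub> x2) [^]\<^bsub>G\<^esub> (10::nat) = \<one>\<^bsub>G\<^esub> \<or>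
      (x1 [^]\<^bsub>G\<^esub> (2::nat) \<otimes>\<^bsub>G\<^esub> x2) [^]\<^bsub>G\<^esub> (2::nat) = \<one>\<^bsub>G\<^esub>)"

definition dident5 :: "('a, 'b) monoid_scheme \<Rightarrow> bool" where
  "dident5 G \<longleftrightarrow> (\<forall>x1\<in>carrier G. \<forall>x2\<in>carrier G.
      x1 [^]\<^bsub>G\<^esub> (6::nat) = \<one>\<^bsub>G\<^esub> \<or> x2 [^]\<^bsub>G\<^esub> (6::nat) = \<one>\<^bsub>G\<^esub> \<or>
      (\<exists>d\<in>{1::nat..4}. (x1 \<otimes>\<^bsub>G\<^esub> x2 [^]\<^bsub>G\<^esub> d) [^]\<^bsub>G\<^esub> (6::nat) = \<one>\<^bsub>G\<^esub>))"

definition A5_basis :: "('a, 'b) monoid_scheme \<Rightarrow> bool" where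
  "A5_basis G \<longleftrightarrow> dident1 G \<and> dident2 G \<and> dident3 G \<and> dident4 G \<and> dident5 G"

definition is_section_of :: "('a, 'b) monoid_scheme \<Rightarrow> ('c, 'd) monoid_scheme \<Rightarrow> bool" where
  "is_section_of G A \<longleftrightarrow> (\<exists>H N. subgroup H A \<and> N \<lhd> (A\<lparr>carrier := H\<rparr>) \<and>
      G \<cong> ((A\<lparr>carrier := H\<rparr>) Mod N))"

end

theory Submission
  imports Defs "HOL-Algebra.Multiplicative_Group" "HOL-Algebra.Group_Action"
begin

text \<open>The identities of \<open>A\<^sub>5\<close> are checked on words: an even permutation of five points is encoded
  by its list of images, and three-cycles generate everything.

  Conversely, let \<open>G\<close> satisfy the identities. Then \<open>G\<close> is finite, its non-trivial elements have
  order 2, 3 or 5, and (3), (4), (5) bound the centralizers: an element of order 3 or 5 is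
  centralized by its powers only, an involution by a group of order 2 or 4. Counting each
  conjugacy class through its centralizer, the class equation reads
  \<open>60 / |G| = 60 - 20 m\<^sub>3 - 12 m\<^sub>5 - 30 a - 15 b\<close>, where \<open>m\<^sub>3\<close>, \<open>m\<^sub>5\<close> are the numbers of classes
  of elements of order 3, 5 and \<open>a\<close>, \<open>b\<close> those of involutions with centralizer of order 2, 4.
  Its few solutions leave the orders 1, 2, 3, 4, 5, 6, 10, 12 and 60. The small groups are cyclic
  or dihedral and embed by normal forms; for order 12, \<open>G\<close> acts on a class of four elements of
  order 3, and for order 60 on the five centralizers of involutions. These actions are faithful,
  and even because all involutions are conjugate and one is a product of two others.\<close>

section \<open>Words for even permutations of five points\<close>

text \<open>Constructor terms let \<open>code_simp\<close> compare and compose permutations by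
  evaluation, which is impossible for functions on all natural numbers.\<close>

datatype point = P1 | P2 | P3 | P4 | P5

datatype word = W point point point point point

text \<open>Everything outside 1 to 4 falls to \<open>P5\<close>, so the encoding is faithful on
  \<open>{1..5}\<close> only; hence the hypotheses \<open>permutes {1..5}\<close> further
  on.\<close>

fun point_of :: "nat \<Rightarrow> point" where
  "point_of n = (if n = 1 then P1 else if n = 2 then P2 else if n = 3 then P3
     else if n = 4 then P4 else P5)"

fun wapp :: "word \<Rightarrow> point \<Rightarrow> point" where
  "wapp (W a b c d e) P1 = a"
| "wapp (W a b c d e) P2 = b"
| "wapp (W a b c d e) P3 = c"
| "wapp (W a b c d e) P4 = d"
| "wapp (W a b c d e) P5 = e"

fun wcomp :: "word \<Rightarrow> word \<Rightarrow> word" where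
  "wcomp w (W a b c d e) = W (wapp w a) (wapp w b) (wapp w c) (wapp w d) (wapp w e)"

definition wunit :: word where
  "wunit = W P1 P2 P3 P4 P5"

fun wpow :: "word \<Rightarrow> nat \<Rightarrow> word" where
  "wpow w 0 = wunit"
| "wpow w (Suc n) = wcomp (wpow w n) w"

definition word_of :: "(nat \<Rightarrow> nat) \<Rightarrow> word" where
  "word_of p = W (point_of (p 1)) (point_of (p 2)) (point_of (p 3)) (point_of (p 4)) (point_of (p 5))"

text \<open>The 60 elements of A_5 in factored form: the powers of the five-cycle represent the
  cosets of A_4, the stabilizer of the fifth point, and A_4 is the Klein four-group times the powers
  of a three-cycle.\<close>

definition words :: "word list" where
  "words = [wcomp (wcomp (wpow (W P2 P3 P4 P5 P1) i) v) (wpow (W P2 P3 P1 P4 P5) j).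
     i \<leftarrow> [0..<5], v \<leftarrow> [wunit, W P2 P1 P4 P3 P5, W P3 P4 P1 P2 P5, W P4 P3 P2 P1 P5], j \<leftarrow> [0..<3]]"

definition elts :: "nat \<Rightarrow> word list" where
  "elts p = [w \<leftarrow> words. w \<noteq> wunit \<and> wpow w p = wunit]"

section \<open>Finite checks by evaluation\<close>

lemma words_exponent: "list_all (\<lambda>w. wpow w 2 = wunit \<or> wpow w 3 = wunit \<or> wpow w 5 = wunit) words"
  by code_simp

lemma words_three_cycles:
  "list_all (\<lambda>a. list_all (\<lambda>b. list_all (\<lambda>c. distinct [a, b, c] \<longrightarrow>
     word_of (cycle_of_list [a, b, c]) \<in> set (elts 3)) [1..<6]) [1..<6]) [1..<6]"
  by code_simp

text \<open>Left multiplication by a three-cycle stays in the list. As three-cycles generate the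
  alternating group, the list therefore contains the code of every even permutation.\<close>

lemma words_closed: "list_all (\<lambda>u. list_all (\<lambda>v. wcomp u v \<in> set words) words) (elts 3)"
  by code_simp

text \<open>Involutions whose pairwise products are involutions commute and are distinct. In A_5
  they are then the three involutions of one Klein four-group, with product 1.\<close>

lemma words_dident3:
  "list_all (\<lambda>u. list_all (\<lambda>v. wcomp u v \<in> set (elts 2) \<longrightarrow>
     list_all (\<lambda>w. wcomp u w \<in> set (elts 2) \<longrightarrow> wcomp v w \<in> set (elts 2) \<longrightarrow>
        wcomp (wcomp u v) w = wunit) (elts 2)) (elts 2)) (elts 2)"
  by code_simp

text \<open>If \<open>u\<close>, \<open>v\<close> and \<open>uv\<close> have order 3, they generate
  a quotient of the solvable triangle group (3,3,3), so for \<open>u\<close> different from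
  \<open>v\<close> a copy of A_4. Modulo its Klein four-group \<open>u\<close> and \<open>v\<close>
  agree, hence the square of \<open>u^-1 v = u^2 v\<close> is 1.\<close>

lemma words_dident4:
  "list_all (\<lambda>u. list_all (\<lambda>v. u = v \<or> wcomp u v \<notin> set (elts 3) \<or>
     wpow (wcomp (wpow u 2) v) 2 = wunit) (elts 3)) (elts 3)"
  by code_simp

text \<open>View A_5 as PSL(2,5), where elements of order 5 have trace 2 or -2, and take
  \<open>v\<close> upper unipotent. Unless \<open>u\<close> is a power of \<open>v\<close>, the
  trace of \<open>u v^d\<close> takes each value in F_5 once for \<open>d\<close> from 0 to 4;
  \<open>d = 0\<close> uses one of the two special values, so at most one other \<open>d\<close>
  gives order 5.\<close>

lemma words_dident5:
  "list_all (\<lambda>u. list_all (\<lambda>v. list_ex (\<lambda>d. wcomp u (wpow v d) \<notin> set (elts 5)) [1..<5]) (elts 5)) (elts 5)"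
  by code_simp

section \<open>Transfer from permutations to words\<close>

lemma word_of_comp:
  assumes "p permutes {1..5}" "q permutes {1..5}"
  shows "word_of (p \<circ> q) = wcomp (word_of p) (word_of q)"
proof -
  have "point_of (p (q i)) = wapp (word_of p) (point_of (q i))" if "i \<in> {1..5}" for i
  proof -
    have "q i \<in> {1..5}"
      using assms(2) that by (simp only: permutes_in_image)
    then have "q i = 1 \<or> q i = 2 \<or> q i = 3 \<or> q i = 4 \<or> q i = 5"
      by auto
    then show ?thesis
      by (auto simp: word_of_def)
  qed
  then show ?thesis
    by (simp add: word_of_def del: point_of.simps)
qed

lemma word_of_id: "word_of id = wunit"
  by (simp add: word_of_def wunit_def)

lemma point_of_inj: "inj_on point_of {1..5}"
proof (rule inj_onI)
  fix i j :: nat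
  assume "i \<in> {1..5}" "j \<in> {1..5}" "point_of i = point_of j"
  moreover from this have "i = 1 \<or> i = 2 \<or> i = 3 \<or> i = 4 \<or> i = 5"
      "j = 1 \<or> j = 2 \<or> j = 3 \<or> j = 4 \<or> j = 5"
    by auto
  ultimately show "i = j" by auto
qed

lemma word_of_inj: "inj_on word_of {p. p permutes {1..5}}"
proof (rule inj_onI)
  fix p q
  assume p: "p \<in> {p. p permutes {1..5}}" and q: "q \<in> {p. p permutes {1..5}}"
    and eq: "word_of p = word_of q"
  have "p i = q i" if i: "i \<in> {1..5}" for i
  proof -
    have "p i \<in> {1..5}" "q i \<in> {1..5}"
      using p q i permutes_in_image[of p "{1..5}" i] permutes_in_image[of q "{1..5}" i] by auto
    moreover have "i = 1 \<or> i = 2 \<or> i = 3 \<or> i = 4 \<or> i = 5"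
      using i by auto
    then have "point_of (p i) = point_of (q i)"
      using eq by (auto simp: word_of_def simp del: point_of.simps)
    ultimately show ?thesis
      using point_of_inj by (meson inj_onD)
  qed
  moreover have "p i = q i" if "i \<notin> {1..5}" for i
    using that p q permutes_not_in[of p "{1..5}" i] permutes_not_in[of q "{1..5}" i] by simp
  ultimately show "p = q" by blast
qed

interpretation A5: group "alt_group 5"
  by (rule alt_group_is_group)

lemma A5_permutes: "p \<in> carrier (alt_group 5) \<Longrightarrow> p permutes {1..5}"
  by (simp add: alt_group_carrier)

lemma word_of_A5_mult:
  assumes "p \<in> carrier (alt_group 5)" "q \<in> carrier (alt_group 5)"
  shows "word_of (p \<otimes>\<^bsub>alt_group 5\<^esub> q) = wcomp (word_of p) (word_of q)"
  using assms by (simp add: alt_group_mult word_of_comp A5_permutes del: One_nat_def)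

lemma word_of_A5_pow:
  assumes "p \<in> carrier (alt_group 5)"
  shows "word_of (p [^]\<^bsub>alt_group 5\<^esub> (n::nat)) = wpow (word_of p) n"
proof (induction n)
  case 0
  then show ?case
    by (simp only: A5.nat_pow_0 alt_group_one word_of_id wpow.simps)
next
  case (Suc n)
  then show ?case
    using assms by (simp add: word_of_A5_mult)
qed

lemma word_of_A5_eq_iff:
  assumes "p \<in> carrier (alt_group 5)" "q \<in> carrier (alt_group 5)"
  shows "word_of p = word_of q \<longleftrightarrow> p = q"
  using assms inj_on_eq_iff[OF word_of_inj] by (simp add: A5_permutes del: One_nat_def)

lemma word_of_A5_one_iff:
  assumes "p \<in> carrier (alt_group 5)"
  shows "word_of p = wunit \<longleftrightarrow> p = \<one>\<^bsub>alt_group 5\<^esub>"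
  using word_of_A5_eq_iff[OF assms A5.one_closed] by (simp only: alt_group_one word_of_id)

lemma word_of_three_cycle:
  assumes "p \<in> three_cycles 5"
  shows "word_of p \<in> set (elts 3)"
proof -
  obtain cs where cs: "p = cycle_of_list cs" "cycle cs" "length cs = 3" "set cs \<subseteq> {1..5}"
    using assms by auto
  obtain a b c where abc: "cs = [a, b, c]"
    using stupid_lemma[OF cs(3)] by auto
  have "a \<in> set [1..<6]" "b \<in> set [1..<6]" "c \<in> set [1..<6]"
    using cs(4) abc by (auto simp del: upt_Suc)
  then show ?thesis
    using words_three_cycles cs(2) unfolding cs(1) abc list_all_iff by blast
qed

text \<open>Turns the inverses occurring in \<open>generate\<close> into products of three-cycles,
  so that \<open>words_closed\<close> covers them.\<close>

lemma three_cycle_inv: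
  assumes "p \<in> three_cycles 5"
  shows "inv\<^bsub>alt_group 5\<^esub> p = p \<otimes>\<^bsub>alt_group 5\<^esub> p"
proof -
  have p: "p \<in> carrier (alt_group 5)"
    using assms three_cycles_incl by blast
  have "wpow (word_of p) 3 = wunit"
    using word_of_three_cycle[OF assms] by (simp add: elts_def)
  then have "p [^]\<^bsub>alt_group 5\<^esub> (3::nat) = \<one>\<^bsub>alt_group 5\<^esub>"
    using p by (simp add: word_of_A5_pow flip: word_of_A5_one_iff)
  then have "(p \<otimes>\<^bsub>alt_group 5\<^esub> p) \<otimes>\<^bsub>alt_group 5\<^esub> p = \<one>\<^bsub>alt_group 5\<^esub>"
    using p by (simp add: numeral_3_eq_3)
  then show ?thesis
    using p by (simp add: A5.inv_equality)
qed

lemma words_unit: "wunit \<in> set words"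
  by code_simp

lemma word_of_A5:
  assumes "p \<in> carrier (alt_group 5)"
  shows "word_of p \<in> set words"
proof -
  have mult: "word_of (p \<otimes>\<^bsub>alt_group 5\<^esub> q) \<in> set words"
    if "p \<in> three_cycles 5" "q \<in> carrier (alt_group 5)" "word_of q \<in> set words" for p q
    using that word_of_three_cycle[OF that(1)] words_closed subsetD[OF three_cycles_incl that(1)]
    unfolding list_all_iff by (simp add: word_of_A5_mult)
  \<comment> \<open>The right factor \<open>q\<close> is kept general: for a product
    \<open>h1 h2\<close> the induction hypothesis is applied first to \<open>q\<close> and then to
    \<open>h2 q\<close>.\<close>
  have "word_of (p \<otimes>\<^bsub>alt_group 5\<^esub> q) \<in> set words"
    if "p \<in> generate (alt_group 5) (three_cycles 5)"
      "q \<in> carrier (alt_group 5)" "word_of q \<in> set words" for p q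
    using that
  proof (induction arbitrary: q)
    case one
    then show ?case by simp
  next
    case (incl h)
    then show ?case by (rule mult)
  next
    case (inv h)
    have h: "h \<in> carrier (alt_group 5)"
      using inv(1) three_cycles_incl by blast
    have "word_of (h \<otimes>\<^bsub>alt_group 5\<^esub> (h \<otimes>\<^bsub>alt_group 5\<^esub> q)) \<in> set words"
      using inv h by (intro mult) simp_all
    then show ?case
      using inv(2) h three_cycle_inv[OF inv(1)] by (simp add: A5.m_assoc)
  next
    case (eng h1 h2)
    have "h1 \<in> carrier (alt_group 5)" "h2 \<in> carrier (alt_group 5)"
      using eng(1,2) by (simp_all add: alt_group_carrier_as_three_cycles)
    then show ?case
      using eng by (simp add: A5.m_assoc)
  qed
  then have "word_of (p \<otimes>\<^bsub>alt_group 5\<^esub> \<one>\<^bsub>alt_group 5\<^esub>) \<in> set words"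
    using assms alt_group_carrier_as_three_cycles[of 5] words_unit word_of_A5_one_iff
    by (metis A5.one_closed)
  then show ?thesis
    using assms by simp
qed

lemma A5_basis_A5: "A5_basis (alt_group 5)"
proof -
  let ?A = "alt_group 5"
  have exponent: "x [^]\<^bsub>?A\<^esub> (2::nat) = \<one>\<^bsub>?A\<^esub> \<or> x [^]\<^bsub>?A\<^esub> (3::nat) = \<one>\<^bsub>?A\<^esub> \<or>
      x [^]\<^bsub>?A\<^esub> (5::nat) = \<one>\<^bsub>?A\<^esub>" if "x \<in> carrier ?A" for x
    using words_exponent word_of_A5[OF that] that unfolding list_all_iff
    by (auto simp: simp flip: word_of_A5_one_iff word_of_A5_pow)
  \<comment> \<open>The exponents 15, 10 and 6 are each divisible by two of the primes 2, 3, 5, so a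
    non-trivial power leaves only the third prime as order.\<close>
  have elts: "word_of x \<in> set (elts p)"
    if "x \<in> carrier ?A" "x [^]\<^bsub>?A\<^esub> n \<noteq> \<one>\<^bsub>?A\<^esub>"
      "2 = p \<or> 2 dvd n" "3 = p \<or> 3 dvd n" "5 = p \<or> 5 dvd n" for x and p n :: nat
  proof -
    have "x [^]\<^bsub>?A\<^esub> m \<noteq> \<one>\<^bsub>?A\<^esub>" if "m dvd n" for m
      using that \<open>x \<in> carrier ?A\<close> \<open>x [^]\<^bsub>?A\<^esub> n \<noteq> \<one>\<^bsub>?A\<^esub>\<close> A5.pow_eq_id dvd_trans by metis
    then have "x [^]\<^bsub>?A\<^esub> p = \<one>\<^bsub>?A\<^esub>"
      using exponent[OF that(1)] that(3-5) by auto
    moreover have "x \<noteq> \<one>\<^bsub>?A\<^esub>"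
      using that(2) by auto
    ultimately have "word_of x \<noteq> wunit" "wpow (word_of x) p = wunit"
      using that(1) by (metis word_of_A5_one_iff word_of_A5_pow A5.nat_pow_closed)+
    then show ?thesis
      using word_of_A5[OF that(1)] by (simp add: elts_def)
  qed
  have elts15: "word_of x \<in> set (elts 2)"
    if "x \<in> carrier ?A" "x [^]\<^bsub>?A\<^esub> (15::nat) \<noteq> \<one>\<^bsub>?A\<^esub>" for x
    by (rule elts[OF that]) simp_all
  have elts10: "word_of x \<in> set (elts 3)"
    if "x \<in> carrier ?A" "x [^]\<^bsub>?A\<^esub> (10::nat) \<noteq> \<one>\<^bsub>?A\<^esub>" for x
    by (rule elts[OF that]) simp_all
  have elts6: "word_of x \<in> set (elts 5)"
    if "x \<in> carrier ?A" "x [^]\<^bsub>?A\<^esub> (6::nat) \<noteq> \<one>\<^bsub>?A\<^esub>" for x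
    by (rule elts[OF that]) simp_all
  have "dident1 ?A"
    unfolding dident1_def
  proof (intro allI impI)
    fix x :: "nat \<Rightarrow> nat \<Rightarrow> nat"
    assume x: "\<forall>i\<le>60. x i \<in> carrier ?A"
    have card: "card (carrier ?A) = 60"
      using alt_group_card_carrier[of 5] by (simp add: fact_numeral)
    have "\<not> inj_on x {..60}"
    proof
      assume "inj_on x {..60}"
      then have "card {..60::nat} \<le> card (carrier ?A)"
        using x card by (intro card_inj_on_le[of x]) (auto intro: card_ge_0_finite)
      then show False
        using card by simp
    qed
    then show "\<exists>i j. i < j \<and> j \<le> 60 \<and> x i = x j"
      unfolding inj_on_def by (metis atMost_iff linorder_neqE_nat)
  qed
  moreover have "dident2 ?A"
    unfolding dident2_def using exponent by blast
  moreover have "dident3 ?A"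
    unfolding dident3_def
  proof (intro ballI)
    fix x y z
    assume c: "x \<in> carrier ?A" "y \<in> carrier ?A" "z \<in> carrier ?A"
    have *: "x \<otimes>\<^bsub>?A\<^esub> y \<otimes>\<^bsub>?A\<^esub> z = \<one>\<^bsub>?A\<^esub>"
      if "word_of x \<in> set (elts 2)" "word_of y \<in> set (elts 2)" "word_of z \<in> set (elts 2)"
        "word_of (x \<otimes>\<^bsub>?A\<^esub> y) \<in> set (elts 2)" "word_of (x \<otimes>\<^bsub>?A\<^esub> z) \<in> set (elts 2)"
        "word_of (y \<otimes>\<^bsub>?A\<^esub> z) \<in> set (elts 2)"
    proof -
      have "wcomp (wcomp (word_of x) (word_of y)) (word_of z) = wunit"
        using words_dident3 that c unfolding list_all_iff by (metis word_of_A5_mult)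
      then show ?thesis
        using c by (simp add: word_of_A5_mult flip: word_of_A5_one_iff)
    qed
    show "x [^]\<^bsub>?A\<^esub> (15::nat) = \<one>\<^bsub>?A\<^esub> \<or> y [^]\<^bsub>?A\<^esub> (15::nat) = \<one>\<^bsub>?A\<^esub> \<or>
      z [^]\<^bsub>?A\<^esub> (15::nat) = \<one>\<^bsub>?A\<^esub> \<or>
      (x \<otimes>\<^bsub>?A\<^esub> y) [^]\<^bsub>?A\<^esub> (15::nat) = \<one>\<^bsub>?A\<^esub> \<or>
      (x \<otimes>\<^bsub>?A\<^esub> z) [^]\<^bsub>?A\<^esub> (15::nat) = \<one>\<^bsub>?A\<^esub> \<or>
      (y \<otimes>\<^bsub>?A\<^esub> z) [^]\<^bsub>?A\<^esub> (15::nat) = \<one>\<^bsub>?A\<^esub> \<or>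
      (\<exists>i\<in>{0::nat,1}. \<exists>j\<in>{0::nat,1}. \<exists>k\<in>{0::nat,1}. (i, j, k) \<noteq> (0, 0, 0) \<and>
          x [^]\<^bsub>?A\<^esub> i \<otimes>\<^bsub>?A\<^esub> y [^]\<^bsub>?A\<^esub> j \<otimes>\<^bsub>?A\<^esub> z [^]\<^bsub>?A\<^esub> k = \<one>\<^bsub>?A\<^esub>)"
    proof (rule ccontr)
      assume neg: "\<not> ?thesis"
      then have "x \<otimes>\<^bsub>?A\<^esub> y \<otimes>\<^bsub>?A\<^esub> z = \<one>\<^bsub>?A\<^esub>"
        using c by (intro * elts15) auto
      \<comment> \<open>This is the disjunct of (3) with exponent vector (1,1,1).\<close>
      moreover have "x \<otimes>\<^bsub>?A\<^esub> y \<otimes>\<^bsub>?A\<^esub> z \<noteq> \<one>\<^bsub>?A\<^esub>"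
        using neg c by fastforce
      ultimately show False by simp
    qed
  qed
  moreover have "dident4 ?A"
    unfolding dident4_def
  proof (intro ballI)
    fix x y
    assume c: "x \<in> carrier ?A" "y \<in> carrier ?A"
    have "x = y \<or> (x [^]\<^bsub>?A\<^esub> (2::nat) \<otimes>\<^bsub>?A\<^esub> y) [^]\<^bsub>?A\<^esub> (2::nat) = \<one>\<^bsub>?A\<^esub>"
      if "word_of x \<in> set (elts 3)" "word_of y \<in> set (elts 3)"
        "word_of (x \<otimes>\<^bsub>?A\<^esub> y) \<in> set (elts 3)"
    proof -
      have "word_of x = word_of y \<or> wpow (wcomp (wpow (word_of x) 2) (word_of y)) 2 = wunit"
        using words_dident4 that c unfolding list_all_iff by (metis word_of_A5_mult)
      then show ?thesis
        using c by (simp add: word_of_A5_mult word_of_A5_pow word_of_A5_eq_iff flip: word_of_A5_one_iff)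
    qed
    then show "x [^]\<^bsub>?A\<^esub> (10::nat) = \<one>\<^bsub>?A\<^esub> \<or> y [^]\<^bsub>?A\<^esub> (10::nat) = \<one>\<^bsub>?A\<^esub> \<or>
      x = y \<or> (x \<otimes>\<^bsub>?A\<^esub> y) [^]\<^bsub>?A\<^esub> (10::nat) = \<one>\<^bsub>?A\<^esub> \<or>
      (x [^]\<^bsub>?A\<^esub> (2::nat) \<otimes>\<^bsub>?A\<^esub> y) [^]\<^bsub>?A\<^esub> (2::nat) = \<one>\<^bsub>?A\<^esub>"
      using elts10 c by blast
  qed
  moreover have "dident5 ?A"
    unfolding dident5_def
  proof (intro ballI)
    fix x y
    assume c: "x \<in> carrier ?A" "y \<in> carrier ?A"
    have "\<exists>d\<in>{1..4}. word_of (x \<otimes>\<^bsub>?A\<^esub> y [^]\<^bsub>?A\<^esub> (d::nat)) \<notin> set (elts 5)"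
      if "word_of x \<in> set (elts 5)" "word_of y \<in> set (elts 5)"
    proof -
      have "list_ex (\<lambda>d. wcomp (word_of x) (wpow (word_of y) d) \<notin> set (elts 5)) [1..<5]"
        using words_dident5[unfolded list_all_iff, rule_format] that .
      then obtain d where d: "d \<in> set [1..<5]" "wcomp (word_of x) (wpow (word_of y) d) \<notin> set (elts 5)"
        unfolding list_ex_iff by (elim bexE)
      have "word_of (x \<otimes>\<^bsub>?A\<^esub> y [^]\<^bsub>?A\<^esub> d) = wcomp (word_of x) (wpow (word_of y) d)"
        using c by (simp add: word_of_A5_mult word_of_A5_pow)
      moreover have "d \<in> {1..4}"
        using d(1) by (simp only: set_upt) simp
      ultimately show ?thesis
        using d(2) by metis
    qed
    then show "x [^]\<^bsub>?A\<^esub> (6::nat) = \<one>\<^bsub>?A\<^esub> \<or> y [^]\<^bsub>?A\<^esub> (6::nat) = \<one>\<^bsub>?A\<^esub> \<or>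
      (\<exists>d\<in>{1::nat..4}. (x \<otimes>\<^bsub>?A\<^esub> y [^]\<^bsub>?A\<^esub> d) [^]\<^bsub>?A\<^esub> (6::nat) = \<one>\<^bsub>?A\<^esub>)"
      using elts6 c by (meson A5.m_closed A5.nat_pow_closed)
  qed
  ultimately show ?thesis
    unfolding A5_basis_def by blast
qed

section \<open>Embeddings by normal forms\<close>

text \<open>The subgroup is the image of \<open>h\<close>, and the normal subgroup divided out is
  trivial.\<close>

lemma is_section_of_inj_hom:
  assumes "group G" "group A" "h \<in> hom G A" "inj_on h (carrier G)"
  shows "is_section_of G A"
proof -
  interpret h: group_hom G A h
    using assms by (simp add: group_hom_def group_hom_axioms_def)
  let ?H = "A\<lparr>carrier := h ` carrier G\<rparr>"
  have sub: "subgroup (h ` carrier G) A"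
    by (rule h.img_is_subgroup)
  interpret H: group ?H
    using h.H.subgroup_imp_group[OF sub] .
  have "h \<in> iso G ?H"
    using assms(3,4) by (auto simp: iso_def hom_def bij_betw_def)
  moreover have "?H Mod {\<one>\<^bsub>?H\<^esub>} \<cong> ?H"
    using H.trivial_factor_iso by (rule is_isoI)
  then have "?H \<cong> ?H Mod {\<one>\<^bsub>?H\<^esub>}"
    by (rule group.iso_sym[OF normal.factorgroup_is_group[OF H.one_is_normal]])
  ultimately have "G \<cong> ?H Mod {\<one>\<^bsub>?H\<^esub>}"
    using iso_trans is_isoI by blast
  then show ?thesis
    using sub H.one_is_normal unfolding is_section_of_def by blast
qed

text \<open>Two normal forms over one index set with the same multiplication rule \<open>m\<close>
  match up as \<open>f i\<close> to \<open>F i\<close>. On the side of \<open>G\<close> the normal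
  form is exhaustive, on the side of \<open>A\<close> it is injective.\<close>

lemma inj_hom_of_common_table:
  assumes f: "bij_betw f I (carrier G)" and F: "inj_on F I" "F ` I \<subseteq> carrier A"
    and table: "\<And>i j. i \<in> I \<Longrightarrow> j \<in> I \<Longrightarrow>
      m i j \<in> I \<and> f i \<otimes>\<^bsub>G\<^esub> f j = f (m i j) \<and> F i \<otimes>\<^bsub>A\<^esub> F j = F (m i j)"
  shows "\<exists>h\<in>hom G A. inj_on h (carrier G)"
proof -
  let ?h = "F \<circ> inv_into I f"
  have inv: "inv_into I f (f i) = i" if "i \<in> I" for i
    using f that by (simp add: bij_betw_def)
  have carrier: "carrier G = f ` I"
    using f by (simp add: bij_betw_def)
  have "?h \<in> hom G A"
    using F table by (auto simp: hom_def carrier inv)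
  moreover have "inj_on ?h (carrier G)"
    using F by (auto simp: carrier inv inj_on_def)
  ultimately show ?thesis by blast
qed

context group
begin

lemma ord_eq_prime:
  assumes "x \<in> carrier G" "x \<noteq> \<one>" "x [^] p = \<one>" "p \<in> {2, 3, 5}"
  shows "ord x = p"
proof -
  have "ord x dvd p" "ord x \<noteq> 1"
    using assms ord_eq_1[of x] by (auto simp: pow_eq_id)
  moreover have "d = p" if "d dvd p" "d \<noteq> 1" for d
  proof -
    have "d \<le> p"
      using that assms(4) by (auto intro: dvd_imp_le)
    moreover have "d \<noteq> 0"
      using that assms(4) by (cases "d = 0") auto
    ultimately have "d \<in> {1, 2, 3, 4, 5}"
      using assms(4) by auto
    then show ?thesis
      using that assms(4) by auto
  qed
  ultimately show ?thesis by blast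
qed

lemma nat_pow_mod:
  assumes "x \<in> carrier G" "x [^] n = \<one>"
  shows "x [^] (i mod n) = x [^] (i::nat)"
proof -
  have "x [^] i = (x [^] n) [^] (i div n) \<otimes> x [^] (i mod n)"
    using assms(1) by (simp add: nat_pow_mult nat_pow_pow)
  then show ?thesis
    using assms by simp
qed

lemma inj_on_pow:
  assumes "x \<in> carrier G"
  shows "inj_on (\<lambda>i::nat. x [^] i) {..<ord x}"
  using ord_inj[OF assms] by (rule inj_on_subset) auto

end

text \<open>Dihedral groups; for \<open>n = 2\<close>, the Klein four-group.\<close>

locale dihedral_pair = group +
  fixes r s and n :: nat
  assumes r: "r \<in> carrier G" and s: "s \<in> carrier G"
    and ord_r: "ord r = n" and n_pos: "n > 0"
    and s_notin: "s \<notin> (\<lambda>i::nat. r [^] i) ` {..<n}"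
    and ss: "s \<otimes> s = \<one>" and srsr: "(s \<otimes> r) \<otimes> (s \<otimes> r) = \<one>"
begin

definition nf :: "nat \<times> bool \<Rightarrow> 'a" where
  "nf = (\<lambda>(i, b). r [^] i \<otimes> (if b then s else \<one>))"

lemma r_pow_n: "r [^] n = \<one>"
  using r ord_r pow_ord_eq_1 by blast

lemma rsr: "r \<otimes> (s \<otimes> r) = s"
proof -
  have "s \<otimes> (r \<otimes> (s \<otimes> r)) = s \<otimes> s"
    using srsr ss r s by (simp add: m_assoc)
  then show ?thesis
    using r s by simp
qed

text \<open>The relation \<open>r s r = s\<close> is applied from the inside outwards, one pair of
  factors at a time.\<close>

lemma pow_s_pow: "r [^] (i::nat) \<otimes> (s \<otimes> r [^] i) = s"
proof (induction i)
  case 0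
  then show ?case using s by simp
next
  case (Suc i)
  have "r [^] Suc i \<otimes> (s \<otimes> r [^] Suc i) = (r [^] i \<otimes> r) \<otimes> (s \<otimes> (r \<otimes> r [^] i))"
    by (subst (2) nat_pow_Suc2) (use r in simp_all)
  also have "\<dots> = r [^] i \<otimes> ((r \<otimes> (s \<otimes> r)) \<otimes> r [^] i)"
    using r s by (simp add: m_assoc)
  finally show ?case
    using Suc by (simp add: rsr)
qed

lemma s_pow: 
  assumes "i < n"
  shows "s \<otimes> r [^] i = r [^] (n - i) \<otimes> s"
proof -
  have "r [^] (n - i) \<otimes> s = r [^] (n - i) \<otimes> (r [^] i \<otimes> (s \<otimes> r [^] i))"
    by (simp add: pow_s_pow)
  also have "\<dots> = (r [^] (n - i) \<otimes> r [^] i) \<otimes> (s \<otimes> r [^] i)"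
    using r s by (simp add: m_assoc)
  also have "\<dots> = s \<otimes> r [^] i"
    using assms r s by (simp add: nat_pow_mult r_pow_n)
  finally show ?thesis by simp
qed

text \<open>A reflection on the left inverts the rotation \<open>r^j\<close>, hence the exponent
  \<open>n - j\<close>; the reduction mod \<open>n\<close> absorbs \<open>j = 0\<close>, where
  \<open>n - j\<close> is \<open>n\<close>.\<close>

lemma nf_mult:
  assumes "j < n"
  shows "nf (i, b) \<otimes> nf (j, c) = nf (if b then ((i + (n - j)) mod n, \<not> c) else ((i + j) mod n, c))"
proof (cases b)
  case True
  have "nf (i, b) \<otimes> nf (j, c) = r [^] i \<otimes> ((s \<otimes> r [^] j) \<otimes> (if c then s else \<one>))"
    using r s True by (simp add: nf_def m_assoc)
  also have "\<dots> = (r [^] i \<otimes> r [^] (n - j)) \<otimes> (s \<otimes> (if c then s else \<one>))"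
    using r s assms by (simp add: s_pow m_assoc)
  also have "\<dots> = nf ((i + (n - j)) mod n, \<not> c)"
    using r s by (simp add: nf_def nat_pow_mult nat_pow_mod r_pow_n ss)
  finally show ?thesis
    using True by simp
next
  case False
  then show ?thesis
    using r s by (simp add: nf_def nat_pow_mod r_pow_n m_assoc flip: nat_pow_mult)
qed

lemma nf_inj: "inj_on nf ({..<n} \<times> UNIV)"
proof (rule inj_onI)
  fix x y
  assume xy: "x \<in> {..<n} \<times> UNIV" "y \<in> {..<n} \<times> UNIV" "nf x = nf y"
  obtain i b j c where ibjc: "x = (i, b)" "y = (j, c)"
    by (metis surj_pair)
  have ij: "i \<in> {..<n}" "j \<in> {..<n}" and eq: "nf (i, b) = nf (j, c)"
    using xy ibjc by simp_all
  \<comment> \<open>Rotations and reflections never coincide, since otherwise \<open>s\<close> would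
    be a rotation.\<close>
  have mixed: "r [^] k \<otimes> s \<noteq> r [^] l" if "k < n" "l < n" for k l :: nat
  proof
    assume "r [^] k \<otimes> s = r [^] l"
    then have "(r [^] (n - k) \<otimes> r [^] k) \<otimes> s = r [^] (n - k) \<otimes> r [^] l"
      using r s by (simp add: m_assoc)
    then have "s = r [^] ((n - k + l) mod n)"
      using r s that by (simp add: nat_pow_mult r_pow_n nat_pow_mod)
    then show False
      using s_notin n_pos by auto
  qed
  have "b = c"
    using eq mixed[of i j] mixed[of j i] ij r s by (auto simp: nf_def split: if_splits)
  moreover from this have "r [^] i = r [^] j"
    using eq r s by (auto simp: nf_def split: if_splits)
  then have "i = j"
    using inj_on_pow[OF r] ij by (simp add: ord_r inj_on_def)
  ultimately show "x = y"
    using ibjc by simp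
qed

lemma nf_carrier: "nf ` ({..<n} \<times> UNIV) \<subseteq> carrier G"
  using r s by (auto simp: nf_def)

text \<open>By counting, the normal forms exhaust \<open>G\<close>; in the possibly larger group
  \<open>D\<close> they are distinct and obey the same table.\<close>

lemma inj_hom_dihedral:
  assumes card: "order G = 2 * n" and D: "dihedral_pair D r' s' n"
  shows "\<exists>h\<in>hom G D. inj_on h (carrier G)"
proof -
  interpret D: dihedral_pair D r' s' n by fact
  let ?m = "\<lambda>(i, b) (j, c). if b then ((i + (n - j)) mod n, \<not> c) else ((i + j) mod n, c)"
  have "card (nf ` ({..<n} \<times> UNIV)) = card (carrier G)"
    using card by (simp add: card_image[OF nf_inj] order_def card_cartesian_product)
  moreover have "finite (carrier G)"
    using card n_pos by (simp add: order_def card_ge_0_finite)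
  ultimately have "nf ` ({..<n} \<times> UNIV) = carrier G"
    using nf_carrier by (simp add: card_subset_eq)
  then have "bij_betw nf ({..<n} \<times> UNIV) (carrier G)"
    by (simp add: bij_betw_def nf_inj)
  then show ?thesis
    using D.nf_inj D.nf_carrier
  proof (rule inj_hom_of_common_table[where m = ?m])
    fix x y :: "nat \<times> bool"
    assume "x \<in> {..<n} \<times> UNIV" "y \<in> {..<n} \<times> UNIV"
    then show "?m x y \<in> {..<n} \<times> UNIV \<and> nf x \<otimes> nf y = nf (?m x y) \<and>
        D.nf x \<otimes>\<^bsub>D\<^esub> D.nf y = D.nf (?m x y)"
      using n_pos nf_mult D.nf_mult by (auto split: prod.splits)
  qed
qed

end

context group
begin

lemma inj_hom_cyclic:
  assumes r: "r \<in> carrier G" "ord r = order G" "order G > 0"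
    and A: "group A" "r' \<in> carrier A" "group.ord A r' = order G"
  shows "\<exists>h\<in>hom G A. inj_on h (carrier G)"
proof -
  interpret A: group A by fact
  let ?f = "\<lambda>i. r [^] (i::nat)" and ?F = "\<lambda>i. r' [^]\<^bsub>A\<^esub> (i::nat)"
  have inj: "inj_on ?f {..<order G}" "inj_on ?F {..<order G}"
    using inj_on_pow[OF r(1)] A.inj_on_pow[OF A(2)] r(2) A(3) by simp_all
  have "card (?f ` {..<order G}) = card (carrier G)"
    using inj by (simp add: card_image order_def)
  moreover have "finite (carrier G)"
    using r(3) by (simp add: order_def card_ge_0_finite)
  ultimately have "?f ` {..<order G} = carrier G"
    using r(1) by (intro card_subset_eq) auto
  then have "bij_betw ?f {..<order G} (carrier G)"
    using inj by (simp add: bij_betw_def)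
  moreover have pow: "r [^] order G = \<one>" "r' [^]\<^bsub>A\<^esub> order G = \<one>\<^bsub>A\<^esub>"
    using r A by (metis pow_ord_eq_1, metis A.pow_ord_eq_1)
  moreover have "?F ` {..<order G} \<subseteq> carrier A"
    using A by auto
  ultimately show ?thesis
    using inj(2) r A
    by (intro inj_hom_of_common_table[where m = "\<lambda>i j. (i + j) mod order G" and f = ?f and F = ?F])
      (auto simp: nat_pow_mod A.nat_pow_mod nat_pow_mult A.nat_pow_mult)
qed

end

section \<open>Conjugacy classes and faithful actions\<close>

context group
begin

definition cent :: "'a \<Rightarrow> 'a set" where
  "cent x = {y \<in> carrier G. y \<otimes> x = x \<otimes> y}"

definition cls :: "'a \<Rightarrow> 'a set" where
  "cls x = (\<lambda>g. g \<otimes> x \<otimes> inv g) ` carrier G"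

lemma conj_eq_iff:
  assumes "g \<in> carrier G" "x \<in> carrier G" "y \<in> carrier G"
  shows "g \<otimes> x \<otimes> inv g = y \<longleftrightarrow> g \<otimes> x = y \<otimes> g"
  using assms by (simp add: inv_solve_right')

lemma conj_mult:
  assumes "g \<in> carrier G" "x \<in> carrier G" "y \<in> carrier G"
  shows "(g \<otimes> x \<otimes> inv g) \<otimes> (g \<otimes> y \<otimes> inv g) = g \<otimes> (x \<otimes> y) \<otimes> inv g"
proof -
  have "inv g \<otimes> (g \<otimes> z) = z" if "z \<in> carrier G" for z
    using assms that by (metis inv_closed l_inv l_one m_assoc)
  then show ?thesis
    using assms by (simp add: m_assoc)
qed

lemma conj_pow:
  assumes "g \<in> carrier G" "x \<in> carrier G"
  shows "(g \<otimes> x \<otimes> inv g) [^] (n::nat) = g \<otimes> x [^] n \<otimes> inv g"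
  by (induction n) (use assms in \<open>simp_all add: conj_mult\<close>)

lemma ord_conj:
  assumes "g \<in> carrier G" "x \<in> carrier G"
  shows "ord (g \<otimes> x \<otimes> inv g) = ord x"
proof -
  have "(g \<otimes> x \<otimes> inv g) [^] n = \<one> \<longleftrightarrow> x [^] n = \<one>" for n :: nat
    using assms by (simp add: conj_pow conj_eq_iff)
  then show ?thesis
    using assms ord_unique[of "g \<otimes> x \<otimes> inv g" "ord x"] by (simp add: pow_eq_id)
qed

lemma conj_conj:
  assumes "g \<in> carrier G" "h \<in> carrier G" "x \<in> carrier G"
  shows "g \<otimes> (h \<otimes> x \<otimes> inv h) \<otimes> inv g = (g \<otimes> h) \<otimes> x \<otimes> inv (g \<otimes> h)"
  using assms by (simp add: m_assoc inv_mult_group)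

lemma orbit_conj:
  assumes "x \<in> carrier G"
  shows "orbit G (\<lambda>g. \<lambda>h\<in>carrier G. g \<otimes> h \<otimes> inv g) x = cls x"
  using assms by (auto simp: orbit_def cls_def)

lemma card_cls:
  assumes "x \<in> carrier G"
  shows "card (cls x) * card (cent x) = order G"
proof -
  have "stabilizer G (\<lambda>g. \<lambda>h\<in>carrier G. g \<otimes> h \<otimes> inv g) x = cent x"
    unfolding stabilizer_def cent_def using assms conj_eq_iff[of _ x x] by auto
  then show ?thesis
    using group_action.orbit_stabilizer_theorem[OF action_by_conjugation assms] assms
    by (simp add: orbit_conj)
qed

lemma cls_subset: "x \<in> carrier G \<Longrightarrow> cls x \<subseteq> carrier G"
  by (auto simp: cls_def)

lemma cls_refl: "x \<in> carrier G \<Longrightarrow> x \<in> cls x"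
  unfolding cls_def by (rule image_eqI[of _ _ \<one>]) simp_all

lemma conj_in_cls:
  assumes "x \<in> carrier G" "g \<in> carrier G" "y \<in> cls x"
  shows "g \<otimes> y \<otimes> inv g \<in> cls x"
  using assms unfolding cls_def by (auto simp: conj_conj)

lemma conj_in_cls_iff:
  assumes "x \<in> carrier G" "g \<in> carrier G" "y \<in> carrier G"
  shows "g \<otimes> y \<otimes> inv g \<in> cls x \<longleftrightarrow> y \<in> cls x"
proof
  assume "g \<otimes> y \<otimes> inv g \<in> cls x"
  then have "inv g \<otimes> (g \<otimes> y \<otimes> inv g) \<otimes> inv (inv g) \<in> cls x"
    using assms by (intro conj_in_cls[of x "inv g"]) auto
  then show "y \<in> cls x"
    using assms by (subst (asm) conj_conj) auto
qed (use assms conj_in_cls in blast)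

text \<open>Such sets are exactly the unions of conjugacy classes.\<close>

definition conj_closed :: "'a set \<Rightarrow> bool" where
  "conj_closed S \<longleftrightarrow> S \<subseteq> carrier G \<and> (\<forall>x\<in>S. \<forall>g\<in>carrier G. g \<otimes> x \<otimes> inv g \<in> S)"

lemma cls_subset_conj_closed: "conj_closed S \<Longrightarrow> x \<in> S \<Longrightarrow> cls x \<subseteq> S"
  by (auto simp: conj_closed_def cls_def)

text \<open>\<open>m\<close> is the number of conjugacy classes that make up \<open>S\<close>.\<close>

lemma conj_closed_card:
  assumes fin: "finite (carrier G)" and "conj_closed S" "\<And>x. x \<in> S \<Longrightarrow> card (cent x) = c"
  obtains m where "c * card S = m * order G"
proof -
  have "finite S"
    using assms finite_subset by (auto simp: conj_closed_def)
  then have "\<exists>m. c * card S = m * order G"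
    using assms(2,3)
  proof (induction S rule: finite_psubset_induct)
    case (psubset S)
    show ?case
    proof (cases "S = {}")
      case False
      then obtain x where x: "x \<in> S" "x \<in> carrier G"
        using psubset.prems(1) by (auto simp: conj_closed_def)
      have sub: "cls x \<subseteq> S"
        using psubset.prems(1) x(1) by (rule cls_subset_conj_closed)
      have "conj_closed (S - cls x)"
        using psubset.prems(1) x(2) conj_in_cls_iff by (auto simp: conj_closed_def)
      moreover have "S - cls x \<subset> S"
        using x cls_refl by blast
      ultimately obtain m where "c * card (S - cls x) = m * order G"
        using psubset by blast
      \<comment> \<open>The removed class contributes exactly one to \<open>m\<close>.\<close>
      moreover have "c * card (cls x) = order G"
        using card_cls[OF x(2)] psubset.prems(2)[OF x(1)] by (simp add: mult.commute)
      moreover have "card S = card (S - cls x) + card (cls x)"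
        using sub psubset.hyps by (metis card_Diff_subset card_mono finite_subset le_add_diff_inverse2)
      ultimately have "c * card S = Suc m * order G"
        by (simp add: distrib_left)
      then show ?thesis by blast
    qed auto
  qed
  then show ?thesis
    using that by blast
qed

text \<open>The case \<open>m = 1\<close> of the preceding count: the class of \<open>x\<close> lies
  in \<open>S\<close> and already has as many elements.\<close>

lemma conj_closed_single_class:
  assumes fin: "finite (carrier G)" and S: "conj_closed S" and x: "x \<in> S"
    and c: "card (cent x) * card S = order G"
  shows "S = cls x"
proof -
  have xG: "x \<in> carrier G"
    using S x by (auto simp: conj_closed_def)
  have sub: "cls x \<subseteq> S"
    using S x by (rule cls_subset_conj_closed)
  have "card (cent x) > 0"
    using c fin xG by (metis card_gt_0_iff empty_iff gr0I mult_is_0 order_def)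
  then have "card (cls x) = card S"
    using card_cls[OF xG] c by (metis mult.commute mult_left_cancel neq0_conv)
  then show ?thesis
    using sub S fin by (metis card_subset_eq conj_closed_def finite_subset)
qed

text \<open>Lets conjugation act on centralizers through the elements centralized. One inclusion is
  direct; the other is the same inclusion for \<open>inv g\<close>.\<close>

lemma conj_cent:
  assumes "g \<in> carrier G" "x \<in> carrier G"
  shows "g <# cent x #> inv g = cent (g \<otimes> x \<otimes> inv g)"
proof -
  have image: "g <# cent x #> inv g = (\<lambda>y. g \<otimes> y \<otimes> inv g) ` cent x"
    by (auto simp: l_coset_def r_coset_def)
  have sub: "(\<lambda>y. g \<otimes> y \<otimes> inv g) ` cent x \<subseteq> cent (g \<otimes> x \<otimes> inv g)"
    if "g \<in> carrier G" "x \<in> carrier G" for g x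
    using that by (auto simp: cent_def conj_mult)
  have "y \<in> (\<lambda>y. g \<otimes> y \<otimes> inv g) ` cent x" if y: "y \<in> cent (g \<otimes> x \<otimes> inv g)" for y
  proof -
    have yG: "y \<in> carrier G"
      using y by (simp add: cent_def)
    have "inv g \<otimes> y \<otimes> inv (inv g) \<in> cent (inv g \<otimes> (g \<otimes> x \<otimes> inv g) \<otimes> inv (inv g))"
      using sub[of "inv g" "g \<otimes> x \<otimes> inv g"] assms y by auto
    then have "inv g \<otimes> y \<otimes> g \<in> cent x"
      using assms by (subst (asm) conj_conj) auto
    moreover have "y = g \<otimes> (inv g \<otimes> y \<otimes> g) \<otimes> inv g"
      using assms(1) yG by (metis conjugation_is_surj)
    ultimately show ?thesis by blast
  qed
  then show ?thesis
    using image sub[OF assms] by blast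
qed

end

text \<open>Faithfulness criterion: the class of a non-trivial element of the kernel would, together
  with the identity, fit into a point stabilizer.\<close>

lemma (in group_action) trivial_kernel:
  assumes fin: "finite (carrier G)" and x: "x \<in> E"
    and small: "\<And>z. z \<in> carrier G \<Longrightarrow> z \<noteq> \<one> \<Longrightarrow> card (group.cent G z) \<le> card (orbit G \<phi> x)"
    and g: "g \<in> carrier G" "\<And>y. y \<in> orbit G \<phi> x \<Longrightarrow> \<phi> g y = y"
  shows "g = \<one>"
proof (rule ccontr)
  interpret group G
    using group_hom group_hom.axioms(1) by blast
  assume "g \<noteq> \<one>"
  let ?S = "stabilizer G \<phi> x"
  have S: "?S \<subseteq> carrier G" "finite ?S"
    using fin by (auto simp: stabilizer_def)
  have class_eq: "card (cls g) * card (cent g) = card (orbit G \<phi> x) * card ?S"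
    using card_cls[OF g(1)] orbit_stabilizer_theorem[OF x] by simp
  have "cls g \<subseteq> ?S"
  proof
    fix z assume "z \<in> cls g"
    then obtain k where k: "k \<in> carrier G" "z = k \<otimes> g \<otimes> inv k"
      by (auto simp: cls_def)
    \<comment> \<open>\<open>g\<close> fixes this point of the orbit, so its conjugate by
      \<open>k\<close> fixes \<open>x\<close>.\<close>
    have "\<phi> (inv k) x \<in> orbit G \<phi> x"
      using k(1) by (auto simp: orbit_def)
    then have "\<phi> z x = \<phi> k (\<phi> (inv k) x)"
      using k g x by (simp add: composition_rule element_image[of "inv k" x])
    also have "\<dots> = \<phi> (k \<otimes> inv k) x"
      using k(1) x composition_rule[of x k "inv k"] by simp
    also have "\<dots> = x"
      using k(1) x id_eq_one by (metis r_inv restrict_apply')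
    finally show "z \<in> ?S"
      using k g(1) by (simp add: stabilizer_def)
  qed
  moreover have "\<one> \<in> ?S"
    using stabilizer_one_closed[OF x] .
  moreover have "\<one> \<notin> cls g"
    using g(1) \<open>g \<noteq> \<one>\<close> by (auto simp: cls_def conj_eq_iff dest!: sym[of \<one>])
  ultimately have "card (cls g) < card ?S"
    using S(2) by (metis psubsetI psubset_card_mono)
  moreover have "card (cent g) \<le> card (orbit G \<phi> x)"
    using small g(1) \<open>g \<noteq> \<one>\<close> by blast
  moreover have "card (orbit G \<phi> x) > 0"
    using fin orbit_refl[OF x] by (auto simp: orbit_def card_gt_0_iff)
  ultimately have "card (cls g) * card (cent g) \<le> card (cls g) * card (orbit G \<phi> x)"
      "card (cls g) * card (orbit G \<phi> x) < card ?S * card (orbit G \<phi> x)"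
    by simp_all
  with class_eq show False
    by (simp add: mult.commute)
qed

text \<open>Numbering the orbit turns the action into permutations; faithfulness on the orbit is
  injectivity.\<close>

lemma (in group_action) inj_hom_orbit:
  assumes fin: "finite (carrier G)" and x: "x \<in> E" and n: "card (orbit G \<phi> x) \<le> n"
    and faithful: "\<And>g. g \<in> carrier G \<Longrightarrow> (\<And>y. y \<in> orbit G \<phi> x \<Longrightarrow> \<phi> g y = y) \<Longrightarrow> g = \<one>"
  shows "\<exists>h\<in>hom G (sym_group n). inj_on h (carrier G)"
proof -
  interpret group G
    using group_hom group_hom.axioms(1) by blast
  interpret S: group "sym_group n"
    by (rule sym_group_is_group)
  define X where "X = orbit G \<phi> x"
  define m where "m = card X"
  have XE: "X \<subseteq> E"
    using x element_image by (auto simp: X_def orbit_def)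
  have "finite X"
    using fin by (auto simp: X_def orbit_def)
  then obtain b where b: "bij_betw b {1..m} X"
    using finite_same_card_bij[of "{1..m}" X] by (auto simp: m_def)
  define b' where "b' = inv_into {1..m} b"
  have b': "bij_betw b' X {1..m}"
    unfolding b'_def using b by (rule bij_betw_inv_into)
  have b'b: "b' (b i) = i" if "i \<in> {1..m}" for i
    using b that by (simp add: b'_def bij_betw_inv_into_left)
  have bb': "b (b' y) = y" if "y \<in> X" for y
    using b that by (simp add: b'_def bij_betw_inv_into_right)
  have bX: "b i \<in> X" if "i \<in> {1..m}" for i
    using b that by (auto simp: bij_betw_def)
  have b'm: "b' y \<in> {1..m}" if "y \<in> X" for y
    using b' that by (auto simp: bij_betw_def)
  \<comment> \<open>The identity outside \<open>{1..m}\<close> lets an orbit with fewer than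
    \<open>n\<close> points still give elements of the symmetric group of degree
    \<open>n\<close>.\<close>
  define h where "h g = (\<lambda>i. if i \<in> {1..m} then b' (\<phi> g (b i)) else i)" for g
  have act: "\<phi> g y \<in> X" if g: "g \<in> carrier G" and y: "y \<in> X" for g y
  proof -
    obtain k where k: "k \<in> carrier G" "y = \<phi> k x"
      using y by (auto simp: X_def orbit_def)
    then have "\<phi> g y = \<phi> (g \<otimes> k) x"
      using g x by (simp add: composition_rule)
    then show ?thesis
      using k(1) g by (auto simp: X_def orbit_def)
  qed
  have h_mult: "h (g \<otimes> k) = h g \<circ> h k" if "g \<in> carrier G" "k \<in> carrier G" for g k
  proof
    fix i
    show "h (g \<otimes> k) i = (h g \<circ> h k) i"
    proof (cases "i \<in> {1..m}")
      case True
      then have X: "b i \<in> X" "\<phi> k (b i) \<in> X"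
        using bX act that by simp_all
      have "h (g \<otimes> k) i = b' (\<phi> g (\<phi> k (b i)))"
        using True X(1) XE that by (auto simp: h_def composition_rule)
      also have "\<dots> = h g (h k i)"
        using True b'm[OF X(2)] bb'[OF X(2)] by (simp add: h_def)
      finally show ?thesis by simp
    qed (auto simp: h_def)
  qed
  have "\<phi> \<one> y = y" if "y \<in> E" for y
    using that id_eq_one by (metis restrict_apply')
  then have h_one: "h \<one> = id"
    using XE bX by (auto simp: h_def fun_eq_iff b'b subset_iff)
  have "h g permutes {1..n}" if g: "g \<in> carrier G" for g
  proof (rule permutes_subset[where S = "{1..m}"])
    have "h g \<circ> h (inv g) = id" "h (inv g) \<circ> h g = id"
      using g h_mult[of g "inv g"] h_mult[of "inv g" g] h_one by simp_all
    then have "bij (h g)"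
      using o_bij by blast
    then show "h g permutes {1..m}"
      by (auto simp: permutes_def h_def bij_iff)
  qed (use n in \<open>auto simp: m_def X_def\<close>)
  then have hom: "h \<in> hom G (sym_group n)"
    using h_mult by (simp add: hom_def sym_group_def)
  interpret h: group_hom G "sym_group n" h
    using hom by unfold_locales
  have "g = \<one>" if g: "g \<in> carrier G" "h g = id" for g
  proof (rule faithful[OF g(1)])
    fix y assume "y \<in> orbit G \<phi> x"
    then have y: "y \<in> X" by (simp add: X_def)
    have "b' (\<phi> g (b (b' y))) = b' y"
      using fun_cong[OF g(2), of "b' y"] b'm[OF y] by (simp add: h_def)
    then have "b' (\<phi> g y) = b' y"
      using y by (simp add: bb')
    then show "\<phi> g y = y"
      using b' act[OF g(1) y] y by (auto simp: bij_betw_def inj_on_def)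
  qed
  then have "inj_on h (carrier G)"
    unfolding h.inj_iff_trivial_ker by (auto simp: kernel_def sym_group_one h_one)
  then show ?thesis
    using hom by blast
qed

section \<open>Centralizers\<close>

context group
begin

text \<open>The last hypothesis is a Bezout certificate that the two exponents are coprime.\<close>

lemma pow_coprime_eq_one:
  fixes m n a b :: nat
  assumes "x \<in> carrier G" "x [^] (m::nat) = \<one>" "x [^] n = \<one>" "m * a = Suc (n * b)"
  shows "x = \<one>"
proof -
  have "x [^] (m * a) = \<one>" "x [^] (n * b) = \<one>"
    using assms by (metis nat_pow_one nat_pow_pow)+
  then show ?thesis
    using assms(1,4) by simp
qed

text \<open>All three elements are their own inverses, so \<open>uv\<close> equals its inverse
  \<open>vu\<close>.\<close>

lemma commute_of_squares:
  assumes "u \<in> carrier G" "v \<in> carrier G"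
    and "u \<otimes> u = \<one>" "v \<otimes> v = \<one>" "(u \<otimes> v) \<otimes> (u \<otimes> v) = \<one>"
  shows "u \<otimes> v = v \<otimes> u"
proof -
  have "inv u = u" "inv v = v" "inv (u \<otimes> v) = u \<otimes> v"
    using assms by (simp_all add: inv_equality)
  then show ?thesis
    using assms(1,2) by (simp add: inv_mult_group)
qed

text \<open>The cyclic subgroup of an element of finite order, indexed without repetition. For
  infinite order \<open>ord x\<close> is 0 and the set is empty.\<close>

definition powers :: "'a \<Rightarrow> 'a set" where
  "powers x = (\<lambda>i::nat. x [^] i) ` {..<ord x}"

lemma card_powers: "x \<in> carrier G \<Longrightarrow> card (powers x) = ord x"
  by (simp add: powers_def card_image inj_on_pow)

lemma pow_in_powers:
  assumes "x \<in> carrier G" "ord x > 0"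
  shows "x [^] (i::nat) \<in> powers x"
  unfolding powers_def using assms nat_pow_mod[of x "ord x" i, symmetric]
  by (intro image_eqI[of _ _ "i mod ord x"]) simp_all

lemma powers_subset_cent: "x \<in> carrier G \<Longrightarrow> powers x \<subseteq> cent x"
  by (auto simp: powers_def cent_def group_commutes_pow)

lemma in_powers_of_mult_pow_eq_one:
  assumes "x \<in> carrier G" "y \<in> carrier G" "y \<otimes> x [^] d = \<one>" "d < ord x"
  shows "y \<in> powers x"
proof -
  have "x [^] (ord x - d) \<otimes> x [^] d = \<one>"
    using assms by (simp add: nat_pow_mult)
  then have "y \<otimes> x [^] d = x [^] (ord x - d) \<otimes> x [^] d"
    using assms(3) by simp
  then have "y = x [^] (ord x - d)"
    using assms(1,2) by simp
  then show ?thesis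
    using assms pow_in_powers by simp
qed

definition elements :: "nat \<Rightarrow> 'a set" where
  "elements p = {x \<in> carrier G. ord x = p}"

lemma conj_closed_elements: "conj_closed (elements p)"
  by (auto simp: conj_closed_def elements_def ord_conj)

text \<open>Conjugate elements have the same class, so orbit counting gives centralizers of equal
  size.\<close>

lemma card_cent_conj:
  assumes "g \<in> carrier G" "x \<in> carrier G" "finite (carrier G)"
  shows "card (cent (g \<otimes> x \<otimes> inv g)) = card (cent x)"
proof -
  have "cls (g \<otimes> x \<otimes> inv g) = cls x"
  proof -
    have "cls x \<subseteq> cls (g \<otimes> x \<otimes> inv g)" if "x \<in> carrier G" "g \<in> carrier G" for x g
    proof -
      have "x \<in> cls (g \<otimes> x \<otimes> inv g)"
        using that conj_in_cls_iff[of "g \<otimes> x \<otimes> inv g" g x] cls_refl by simp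
      then show ?thesis
        using that conj_in_cls[of "g \<otimes> x \<otimes> inv g" _ x] by (auto simp: cls_def[of x])
    qed
    moreover have "cls (g \<otimes> x \<otimes> inv g) \<subseteq> cls x"
      using assms conj_in_cls cls_refl by (auto simp: cls_def[of "g \<otimes> x \<otimes> inv g"])
    ultimately show ?thesis
      using assms by blast
  qed
  moreover have "card (cls x) > 0"
    using assms cls_refl[of x] finite_subset[OF cls_subset] by (auto simp: card_gt_0_iff)
  ultimately show ?thesis
    using card_cls[of x] card_cls[of "g \<otimes> x \<otimes> inv g"] assms
    by (metis inv_closed m_closed mult_left_cancel neq0_conv)
qed

end

section \<open>Centralizers in a group satisfying the identities\<close>

locale A5_basis_group = group +
  assumes basis: "A5_basis G"
begin

lemma finite_carrier: "finite (carrier G)"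
proof (rule ccontr)
  assume "infinite (carrier G)"
  then obtain f :: "nat \<Rightarrow> 'a" where f: "inj f" "range f \<subseteq> carrier G"
    using infinite_countable_subset by blast
  then obtain i j where "i < j" "f i = f j"
    using basis unfolding A5_basis_def dident1_def by blast
  then show False
    using f(1) by (auto dest: injD)
qed

lemma basis_parts: "dident3 G" "dident4 G" "dident5 G"
  using basis by (simp_all add: A5_basis_def)

lemmas dident3_rule = basis_parts(1)[unfolded dident3_def, rule_format]
lemmas dident4_rule = basis_parts(2)[unfolded dident4_def, rule_format]
lemmas dident5_rule = basis_parts(3)[unfolded dident5_def, rule_format]

lemma exponent:
  "x \<in> carrier G \<Longrightarrow> x [^] (2::nat) = \<one> \<or> x [^] (3::nat) = \<one> \<or> x [^] (5::nat) = \<one>"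
  using basis by (simp add: A5_basis_def dident2_def)

lemma ord_cases:
  assumes "x \<in> carrier G"
  shows "x = \<one> \<and> ord x = 1 \<or> x \<noteq> \<one> \<and> ord x \<in> {2, 3, 5}"
  using exponent[OF assms] ord_eq_prime[OF assms] by fastforce

text \<open>By (2), the product of two commuting elements cannot have the product of two distinct
  primes as its order.\<close>

lemma ord_eq_of_commute:
  assumes "x \<in> carrier G" "y \<in> carrier G" "x \<otimes> y = y \<otimes> x" "x \<noteq> \<one>" "y \<noteq> \<one>"
  shows "ord x = ord y"
proof -
  have "\<exists>r\<in>{2, 3, 5::nat}. (x \<otimes> y) [^] r = \<one>"
    using exponent[of "x \<otimes> y"] assms(1,2) by simp
  then obtain r where r: "r \<in> {2, 3, 5::nat}" "(x \<otimes> y) [^] r = \<one>"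
    by blast
  have "x [^] (r * k) \<otimes> y [^] (r * k) = \<one>" for k
    using r(2) assms by (metis m_closed nat_pow_one nat_pow_pow pow_mult_distrib)
  \<comment> \<open>These exponents kill one factor each. The resulting divisibilities would force
    two distinct prime orders both to equal \<open>r\<close>.\<close>
  from this[of "ord y"] this[of "ord x"]
  have "x [^] (r * ord y) = \<one>" "y [^] (r * ord x) = \<one>"
    using assms pow_eq_id[of y "r * ord y"] pow_eq_id[of x "r * ord x"] by simp_all
  then have "ord x dvd r * ord y" "ord y dvd r * ord x"
    using assms by (simp_all add: pow_eq_id)
  moreover have "ord x \<in> {2, 3, 5}" "ord y \<in> {2, 3, 5}"
    using ord_cases assms by blast+
  ultimately show ?thesis
    using r(1) by auto
qed

lemma in_cent_ord:
  assumes "x \<in> carrier G" "x \<noteq> \<one>" "y \<in> cent x" "y \<noteq> \<one>"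
  shows "ord y = ord x"
  using assms ord_eq_of_commute[of y x] by (simp add: cent_def)

text \<open>A non-trivial \<open>y\<close> commuting with \<open>x\<close> has the same order
  \<open>p\<close>, and so \<open>y x^d\<close> has exponent \<open>p\<close>. The disjuncts of (4)
  for \<open>p = 3\<close> and of (5) for \<open>p = 5\<close> that survive give
  \<open>y = x\<close> or an exponent coprime to \<open>p\<close>, hence \<open>y x^d = 1\<close>
  for some \<open>d\<close>.\<close>

lemma cent_odd:
  assumes x: "x \<in> carrier G" "ord x \<in> {3, 5}"
  shows "cent x = powers x"
proof
  show "cent x \<subseteq> powers x"
  proof
    fix y assume y: "y \<in> cent x"
    have x1: "x \<noteq> \<one>"
      using x(2) by auto
    have yG: "y \<in> carrier G" and comm: "y \<otimes> x = x \<otimes> y"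
      using y by (auto simp: cent_def)
    show "y \<in> powers x"
    proof (cases "y = \<one>")
      case True
      then show ?thesis
        using pow_in_powers[of x 0] x by auto
    next
      case False
      have ord_y: "ord y = ord x"
        using in_cent_ord[OF x(1) x1 y False] .
      have comm_pow: "x [^] d \<otimes> y = y \<otimes> x [^] d" for d :: nat
        using comm x(1) yG by (simp add: group_commutes_pow)
      have pow: "(y \<otimes> x [^] (d::nat)) [^] ord x = \<one>" for d
      proof -
        have "(y \<otimes> x [^] d) [^] ord x = y [^] ord x \<otimes> (x [^] d) [^] ord x"
          using comm_pow x(1) yG by (intro pow_mult_distrib) simp_all
        moreover have "(x [^] d) [^] ord x = \<one>"
          using x(1) by (simp add: nat_pow_pow pow_eq_id)
        moreover have "y [^] ord x = \<one>"
          using yG by (simp add: pow_eq_id ord_y)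
        ultimately show ?thesis by simp
      qed
      from x(2) consider "ord x = 3" | "ord x = 5" by blast
      then show ?thesis
      proof cases
        case 1
        have pow1: "(x \<otimes> y) [^] (3::nat) = \<one>"
          using pow[of 1] x(1) comm 1 by simp
        have pow2: "(x [^] (2::nat) \<otimes> y) [^] (3::nat) = \<one>"
          using pow[of 2] comm_pow[of 2] 1 by simp
        have "x [^] (10::nat) \<noteq> \<one>" "y [^] (10::nat) \<noteq> \<one>"
          using x(1) yG ord_y 1 by (simp_all add: pow_eq_id)
        then consider "x = y" | "(x \<otimes> y) [^] (10::nat) = \<one>"
          | "(x [^] (2::nat) \<otimes> y) [^] (2::nat) = \<one>"
          using dident4_rule[OF x(1) yG] by blast
        then show ?thesis
        proof cases
          case 1
          then show ?thesis
            using pow_in_powers[of x 1] x by auto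
        next
          case 2
          \<comment> \<open>Coprimality of 10 and 3: 10 = 3 * 3 + 1.\<close>
          have "x \<otimes> y = \<one>"
            by (rule pow_coprime_eq_one[of _ 10 3 1 3]) (use 2 pow1 x(1) yG in simp_all)
          then show ?thesis
            using x(1) yG \<open>ord x = 3\<close> comm
            by (intro in_powers_of_mult_pow_eq_one[of x y 1]) simp_all
        next
          case 3
          have "x [^] (2::nat) \<otimes> y = \<one>"
            by (rule pow_coprime_eq_one[of _ 2 3 2 1]) (use 3 pow2 x(1) yG in simp_all)
          then show ?thesis
            using x(1) yG \<open>ord x = 3\<close> comm_pow[of 2]
            by (intro in_powers_of_mult_pow_eq_one[of x y 2]) simp_all
        qed
      next
        case 2
        have "x [^] (6::nat) \<noteq> \<one>" "y [^] (6::nat) \<noteq> \<one>"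
          using x(1) yG ord_y 2 by (simp_all add: pow_eq_id)
        \<comment> \<open>Identity (5) is used with \<open>y\<close> in the first place, so that the
          powers of \<open>x\<close> vary.\<close>
        then have "\<exists>d\<in>{1..4}. (y \<otimes> x [^] (d::nat)) [^] (6::nat) = \<one>"
          using dident5_rule[OF yG x(1)] by simp
        then obtain d :: nat where d: "d \<in> {1..4}" "(y \<otimes> x [^] d) [^] (6::nat) = \<one>"
          by blast
        have "y \<otimes> x [^] d = \<one>"
          by (rule pow_coprime_eq_one[of _ 6 5 1 1]) (use d(2) pow[of d] x(1) yG 2 in simp_all)
        then show ?thesis
          using d x(1) yG 2 by (intro in_powers_of_mult_pow_eq_one[of x y d]) auto
      qed
    qed
  qed
qed (use x powers_subset_cent in blast)

lemma card_cent_odd: "x \<in> carrier G \<Longrightarrow> ord x \<in> {3, 5} \<Longrightarrow> card (cent x) = ord x"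
  by (simp add: cent_odd card_powers)

lemma cent_mult_closed:
  assumes "x \<in> carrier G" "u \<in> cent x" "v \<in> cent x"
  shows "u \<otimes> v \<in> cent x"
proof -
  have G: "u \<in> carrier G" "v \<in> carrier G" and comm: "u \<otimes> x = x \<otimes> u" "v \<otimes> x = x \<otimes> v"
    using assms(2,3) by (simp_all add: cent_def)
  have "u \<otimes> v \<otimes> x = u \<otimes> (x \<otimes> v)"
    using G assms(1) comm(2) by (simp add: m_assoc)
  also have "\<dots> = x \<otimes> u \<otimes> v"
    using G assms(1) comm(1) by (simp flip: m_assoc)
  finally show ?thesis
    using G assms(1) by (simp add: cent_def m_assoc)
qed

lemma cent_involution_square:
  assumes t: "t \<in> carrier G" "ord t = 2" and u: "u \<in> cent t"
  shows "u \<otimes> u = \<one>"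
proof (cases "u = \<one>")
  case False
  have "t \<noteq> \<one>"
    using t by auto
  then have "ord u = 2"
    using in_cent_ord[OF t(1) _ u False] t(2) by simp
  then have "u [^] (2::nat) = \<one>"
    using u pow_eq_id[of u 2] by (simp add: cent_def)
  then show ?thesis
    using u by (simp add: cent_def numeral_2_eq_2)
qed auto

lemma cent_involution_commute:
  assumes "t \<in> carrier G" "ord t = 2" "u \<in> cent t" "v \<in> cent t"
  shows "u \<otimes> v = v \<otimes> u"
  using assms cent_involution_square[of t] cent_mult_closed[of t u v]
  by (intro commute_of_squares) (auto simp: cent_def)

text \<open>The centralizer is an elementary abelian 2-group, and (3) forbids three elements
  independent over F_2 in it; so its rank is 1 or 2.\<close>

lemma cent_involution:
  assumes t: "t \<in> carrier G" "ord t = 2"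
  obtains "cent t = {\<one>, t}" "card (cent t) = 2"
  | s where "cent t = {\<one>, t, s, t \<otimes> s}" "card (cent t) = 4"
      "s \<in> carrier G" "ord s = 2" "ord (t \<otimes> s) = 2" "s \<otimes> t = t \<otimes> s" "s \<noteq> t"
proof (cases "cent t = {\<one>, t}")
  case True
  moreover have "t \<noteq> \<one>"
    using t by auto
  ultimately show ?thesis
    using that(1) by simp
next
  case False
  have t1: "t \<noteq> \<one>"
    using t by auto
  have "{\<one>, t} \<subseteq> cent t"
    using t(1) by (auto simp: cent_def)
  then obtain s where s: "s \<in> cent t" "s \<noteq> \<one>" "s \<noteq> t"
    using False by blast
  note sq = cent_involution_square[OF t] and mult = cent_mult_closed[OF t(1)]
    and comm = cent_involution_commute[OF t]
  have eqI: "v = u" if "u \<in> cent t" "v \<in> cent t" "u \<otimes> v = \<one>" for u v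
  proof -
    have "u \<otimes> v = u \<otimes> u"
      using sq[OF that(1)] that(3) by simp
    then show ?thesis
      using that(1,2) by (simp add: cent_def)
  qed
  have odd: "u [^] (15::nat) \<noteq> \<one>" if "u \<in> cent t" "u \<noteq> \<one>" for u
    using in_cent_ord[OF t(1) t1 that] that t(2) by (simp add: cent_def pow_eq_id)
  have tc: "t \<in> cent t"
    using t(1) by (simp add: cent_def)
  have G: "s \<in> carrier G"
    using s(1) by (simp add: cent_def)
  have ts: "t \<otimes> s \<noteq> \<one>"
    using eqI[OF tc s(1)] s(3) by blast
  have "u \<in> {\<one>, t, s, t \<otimes> s}" if u: "u \<in> cent t" for u
  proof (rule ccontr)
    assume neg: "u \<notin> {\<one>, t, s, t \<otimes> s}"
    have uG: "u \<in> carrier G"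
      using u by (simp add: cent_def)
    \<comment> \<open>With \<open>t\<close>, \<open>s\<close>, \<open>u\<close> and
      \<open>t s\<close> these make up the seven non-empty products, all non-trivial.\<close>
    have ne: "t \<otimes> u \<noteq> \<one>" "s \<otimes> u \<noteq> \<one>" "t \<otimes> s \<otimes> u \<noteq> \<one>"
      using eqI[OF tc u] eqI[OF s(1) u] eqI[OF mult[OF tc s(1)] u] neg by blast+
    \<comment> \<open>The six disjuncts with exponent 15 fail, because non-trivial elements of the
      centralizer have order 2.\<close>
    have "\<exists>i\<in>{0::nat,1}. \<exists>j\<in>{0::nat,1}. \<exists>k\<in>{0::nat,1}. (i, j, k) \<noteq> (0, 0, 0) \<and>
        t [^] i \<otimes> s [^] j \<otimes> u [^] k = \<one>"
      using dident3_rule[OF t(1) G uG] odd[OF tc] odd[OF s(1)] odd[OF u] odd[OF mult[OF tc s(1)]]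
        odd[OF mult[OF tc u]] odd[OF mult[OF s(1) u]] t1 s(2) neg ts ne
      by (metis insertCI)
    then show False
      using t(1) G uG t1 s(2) ts ne neg by auto
  qed
  moreover have "{\<one>, t, s, t \<otimes> s} \<subseteq> cent t"
    using tc s(1) mult[OF tc s(1)] by (auto simp: cent_def)
  ultimately have cent: "cent t = {\<one>, t, s, t \<otimes> s}"
    by blast
  moreover have "card {\<one>, t, s, t \<otimes> s} = 4"
    using t1 s ts t(1) G l_cancel_one[of t s] r_cancel_one[of s t] by (auto simp: card_insert_if)
  moreover have "ord s = 2" "ord (t \<otimes> s) = 2"
    using in_cent_ord[OF t(1) t1] s mult[OF tc s(1)] ts t(2) by simp_all
  ultimately show ?thesis
    using that(2) G s(3) comm[OF s(1) tc] by metis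
qed

end

section \<open>The class equation\<close>

context A5_basis_group
begin

text \<open>Fixing the centralizer size makes \<open>conj_closed_card\<close> applicable.\<close>

definition involutions :: "nat \<Rightarrow> 'a set" where
  "involutions c = {t \<in> elements 2. card (cent t) = c}"

lemma elements_subset: "elements p \<subseteq> carrier G"
  by (auto simp: elements_def)

lemma finite_elements: "finite (elements p)"
  using finite_carrier elements_subset by (rule finite_subset[rotated])

lemma conj_closed_involutions: "conj_closed (involutions c)"
  by (auto simp: conj_closed_def involutions_def elements_def ord_conj card_cent_conj finite_carrier)

lemma elements_2: "elements 2 = involutions 2 \<union> involutions 4"
proof -
  have "card (cent t) = 2 \<or> card (cent t) = 4" if "t \<in> elements 2" for t
    by (rule cent_involution[of t]) (use that in \<open>simp_all add: elements_def\<close>)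
  then show ?thesis
    by (auto simp: involutions_def)
qed

lemma class_equation:
  "order G = 1 + card (elements 3) + card (elements 5) + card (involutions 2) + card (involutions 4)"
proof -
  have fin: "finite (involutions c)" for c
    using finite_elements[of 2] by (auto simp: involutions_def)
  have "carrier G = {\<one>} \<union> elements 3 \<union> elements 5 \<union> elements 2"
    using ord_cases by (auto simp: elements_def)
  also have "\<dots> = {\<one>} \<union> elements 3 \<union> elements 5 \<union> involutions 2 \<union> involutions 4"
    by (simp add: elements_2 Un_assoc)
  finally have "order G = card ({\<one>} \<union> elements 3 \<union> elements 5 \<union> involutions 2 \<union> involutions 4)"
    by (simp add: order_def)
  also have "\<dots> = card ({\<one>} \<union> elements 3 \<union> elements 5 \<union> involutions 2) + card (involutions 4)"
    by (rule card_Un_disjoint) (auto simp: fin finite_elements, auto simp: involutions_def elements_def)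
  also have "card ({\<one>} \<union> elements 3 \<union> elements 5 \<union> involutions 2) =
      card ({\<one>} \<union> elements 3 \<union> elements 5) + card (involutions 2)"
    by (rule card_Un_disjoint) (auto simp: fin finite_elements, auto simp: involutions_def elements_def)
  also have "card ({\<one>} \<union> elements 3 \<union> elements 5) = card ({\<one>} \<union> elements 3) + card (elements 5)"
    by (rule card_Un_disjoint) (auto simp: fin finite_elements, auto simp: elements_def)
  also have "card ({\<one>} \<union> elements 3) = 1 + card (elements 3)"
    by (subst card_Un_disjoint) (auto simp: finite_elements, auto simp: elements_def)
  finally show ?thesis .
qed

text \<open>If all elements of odd order \<open>p\<close> are conjugate, then \<open>x\<close> is conjugate to its square.
  Conjugation by \<open>y\<close> squares \<open>x\<close>, so \<open>y\<^sup>n\<close> raises it to the power \<open>2\<^sup>n\<close>; comparing with the order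
  of \<open>y\<close> leaves only \<open>p = 3\<close> and an involution \<open>y\<close>.\<close>

lemma single_class_odd:
  assumes p: "p \<in> {3, 5}" and card: "p * card (elements p) = order G"
  shows "p = 3 \<and> elements 2 \<noteq> {}"
proof -
  have "order G > 0"
    using finite_carrier by (metis card_gt_0_iff empty_iff one_closed order_def)
  then obtain x where x: "x \<in> elements p"
    using card by (metis all_not_in_conv card.empty mult_0_right less_irrefl)
  then have xG: "x \<in> carrier G" and ord_x: "ord x = p"
    by (simp_all add: elements_def)
  \<comment> \<open>Each centralizer has \<open>p\<close> elements, so the cardinality hypothesis
    leaves room for one class only.\<close>
  have "elements p = cls x"
    using finite_carrier conj_closed_elements x
    by (rule conj_closed_single_class) (use card_cent_odd[OF xG] ord_x p card in simp)
  moreover have "x [^] (2::nat) \<in> cent x"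
    using powers_subset_cent[OF xG] pow_in_powers[of x 2] xG ord_x p by auto
  then have "ord (x [^] (2::nat)) = p"
    using in_cent_ord[OF xG] xG ord_x p pow_eq_id[of x 2] ord_eq_1[of x] by auto
  ultimately have "x [^] (2::nat) \<in> cls x"
    using xG by (auto simp: elements_def)
  then obtain y where y: "y \<in> carrier G" "y \<otimes> x \<otimes> inv y = x [^] (2::nat)"
    by (auto simp: cls_def)
  have iter: "y [^] n \<otimes> x \<otimes> inv (y [^] n) = x [^] ((2::nat) ^ n)" for n :: nat
  proof (induction n)
    case 0
    then show ?case using xG by simp
  next
    case (Suc n)
    have "y [^] Suc n \<otimes> x \<otimes> inv (y [^] Suc n) = y [^] n \<otimes> (y \<otimes> x \<otimes> inv y) \<otimes> inv (y [^] n)"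
      using xG y(1) by (simp add: conj_conj)
    also have "\<dots> = x [^] ((2::nat) ^ n * 2)"
      using xG y Suc by (simp add: nat_pow_pow flip: conj_pow)
    finally show ?case
      by (simp add: mult.commute)
  qed
  \<comment> \<open>If \<open>y^n = 1\<close>, conjugation by \<open>y^n\<close> is trivial, so
    \<open>x\<close> equals its power with exponent \<open>2^n\<close>.\<close>
  have pow: "p dvd 2 ^ n - 1" if "y [^] n = \<one>" for n :: nat
  proof -
    have "x [^] (2 ^ n - 1 :: nat) \<otimes> x = x [^] Suc (2 ^ n - 1)"
      by (rule nat_pow_Suc[symmetric])
    also have "Suc (2 ^ n - 1) = 2 ^ n"
      by simp
    also have "x [^] ((2::nat) ^ n) = x"
      using iter[of n] that xG by simp
    finally have "x [^] (2 ^ n - 1 :: nat) = \<one>"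
      using xG by simp
    then show ?thesis
      using xG ord_x pow_eq_id by blast
  qed
  have "y \<noteq> \<one>"
    using pow[of 1] y(1) p by auto
  then consider "ord y = 2" | "ord y = 3" | "ord y = 5"
    using ord_cases[OF y(1)] by auto
  then show ?thesis
  proof cases
    case 1
    \<comment> \<open>Here 3 = 2^2 - 1 excludes \<open>p = 5\<close>, and \<open>y\<close> is the
      required involution. The values 7 and 31 below arise likewise and exclude both primes.\<close>
    then have "p dvd 3"
      using pow[of 2] y(1) by (simp add: pow_eq_id)
    then show ?thesis
      using 1 y(1) p by (auto simp: elements_def)
  next
    case 2
    then have "p dvd 7"
      using pow[of 3] y(1) by (simp add: pow_eq_id)
    then show ?thesis
      using p by auto
  next
    case 3
    then have "p dvd 31"
      using pow[of 5] y(1) by (simp add: pow_eq_id)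
    then show ?thesis
      using p by auto
  qed
qed

text \<open>The class counts \<open>m3\<close>, \<open>m5\<close>, \<open>a\<close>,
  \<open>b\<close> satisfy a linear equation with unit fractions, which has finitely many
  solutions.\<close>

lemma order_cases:
  obtains "order G \<in> {1, 2, 3, 4, 5}"
  | "order G = 6" "card (elements 3) = 2"
  | "order G = 10" "card (elements 5) = 4"
  | "order G = 12" "elements 3 \<noteq> {}" "elements 5 = {}" "involutions 2 = {}" "card (involutions 4) = 3"
  | "order G = 60" "involutions 2 = {}" "card (involutions 4) = 15"
proof -
  define g where "g = order G"
  have fin: "finite (involutions c)" for c
    using finite_elements[of 2] by (auto simp: involutions_def)
  have g: "g > 0"
    using finite_carrier unfolding g_def by (metis card_gt_0_iff empty_iff one_closed order_def)
  have odd: "\<exists>m. p * card (elements p) = m * g" if "p \<in> {3, 5}" for p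
    using conj_closed_card[OF finite_carrier conj_closed_elements, of p p] card_cent_odd that
    unfolding g_def elements_def by (metis (mono_tags, lifting) mem_Collect_eq)
  obtain m3 where m3: "3 * card (elements 3) = m3 * g"
    using odd by blast
  obtain m5 where m5: "5 * card (elements 5) = m5 * g"
    using odd by blast
  have inv: "\<exists>m. c * card (involutions c) = m * g" for c
    using conj_closed_card[OF finite_carrier conj_closed_involutions, of c c]
    unfolding g_def involutions_def by (metis (mono_tags, lifting) mem_Collect_eq)
  obtain a where a: "2 * card (involutions 2) = a * g"
    using inv by blast
  obtain b where b: "4 * card (involutions 4) = b * g"
    using inv by blast
  \<comment> \<open>60 is the least common multiple of the centralizer orders 2, 3, 4, 5 and clears
    all denominators.\<close>
  have "60 * g = 60 + 20 * (3 * card (elements 3)) + 12 * (5 * card (elements 5))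
      + 30 * (2 * card (involutions 2)) + 15 * (4 * card (involutions 4))"
    using class_equation by (simp add: g_def)
  also have "\<dots> = 60 + (20 * m3 + 12 * m5 + 30 * a + 15 * b) * g"
    unfolding m3 m5 a b by (simp add: algebra_simps)
  finally have eq: "60 * g = 60 + (20 * m3 + 12 * m5 + 30 * a + 15 * b) * g" .
  \<comment> \<open>The identity element accounts for the strict inequality, which bounds all four
    class counts.\<close>
  then have "(20 * m3 + 12 * m5 + 30 * a + 15 * b) * g < 60 * g"
    by linarith
  then have lt: "20 * m3 + 12 * m5 + 30 * a + 15 * b < 60"
    by simp
  have "4 dvd g" if "b \<noteq> 0"
  proof -
    have "involutions 4 \<noteq> {}"
      using b that g by auto
    then obtain t where "t \<in> carrier G" "card (cent t) = 4"
      by (auto simp: involutions_def elements_def)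
    then show ?thesis
      using card_cls[of t] unfolding g_def by (metis dvd_triv_right)
  qed
  \<comment> \<open>Removes the numerical solutions of order 20. The condition for
    \<open>m3 = 1\<close> removes order 15, where \<open>m5\<close> would be 3.\<close>
  moreover have "m5 \<noteq> 1"
    using single_class_odd[of 5] m5 by (auto simp: g_def)
  moreover have "a \<noteq> 0 \<or> b \<noteq> 0" if "m3 = 1"
  proof -
    have "elements 2 \<noteq> {}"
      using single_class_odd[of 3] m3 that by (auto simp: g_def)
    then have "card (involutions 2) \<noteq> 0 \<or> card (involutions 4) \<noteq> 0"
      using finite_elements[of 2] by (auto simp: elements_2)
    then show ?thesis
      using a b by (metis mult_eq_0_iff zero_neq_numeral)
  qed
  moreover have "m3 \<in> {0, 1, 2}" "m5 \<in> {0, 1, 2, 3, 4}" "a \<in> {0, 1}" "b \<in> {0, 1, 2, 3}"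
    using lt by auto
  ultimately have "g \<in> {1, 2, 3, 4, 5} \<or> g = 6 \<and> m3 = 1 \<or> g = 10 \<and> m5 = 2
      \<or> g = 12 \<and> m3 = 2 \<and> m5 = 0 \<and> a = 0 \<and> b = 1 \<or> g = 60 \<and> a = 0 \<and> b = 1"
    using eq by (elim insertE emptyE) (simp_all, presburger+)
  then show ?thesis
  proof (elim disjE conjE)
    assume *: "g = 12" "m3 = 2" "m5 = 0" "a = 0" "b = 1"
    then have "card (elements 3) = 8" "card (elements 5) = 0" "card (involutions 2) = 0"
        "card (involutions 4) = 3"
      using m3 m5 a b by simp_all
    moreover from this have "elements 3 \<noteq> {}" by auto
    ultimately show ?thesis
      using that(4) * finite_elements fin by (simp add: g_def)
  next
    assume *: "g = 60" "a = 0" "b = 1"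
    then have "card (involutions 2) = 0" "card (involutions 4) = 15"
      using a b by simp_all
    then show ?thesis
      using that(5) * fin by (simp add: g_def)
  qed (use m3 m5 that(1-3) in \<open>auto simp: g_def\<close>)
qed

end

section \<open>Embeddings into the alternating group\<close>

text \<open>The transpositions may overlap in one point, so three-cycles are covered as
  well.\<close>

lemma A5_double_transposition:
  assumes "a \<noteq> b" "c \<noteq> d" "{a, b, c, d} \<subseteq> {1..5}"
  shows "transpose a b \<circ> transpose c d \<in> carrier (alt_group 5)"
  using assms unfolding alt_group_carrier
  by (simp add: permutes_compose permutes_swap_id evenperm_comp permutation_swap_id evenperm_swap)

text \<open>The relations of \<open>dihedral_pair\<close> in a form open to evaluation; for prime
  \<open>n\<close> the first two conditions say that \<open>u\<close> has order
  \<open>n\<close>.\<close>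

definition dihedral_words :: "word \<Rightarrow> word \<Rightarrow> nat \<Rightarrow> bool" where
  "dihedral_words u v n \<longleftrightarrow> u \<noteq> wunit \<and> wpow u n = wunit \<and> list_all (\<lambda>i. v \<noteq> wpow u i) [0..<n] \<and>
    wcomp v v = wunit \<and> wcomp (wcomp v u) (wcomp v u) = wunit"

lemma A5_dihedral_pair:
  assumes r: "r \<in> carrier (alt_group 5)" and s: "s \<in> carrier (alt_group 5)"
    and n: "n \<in> {2, 3, 5}" and words: "dihedral_words (word_of r) (word_of s) n"
  shows "dihedral_pair (alt_group 5) r s n"
proof
  show "A5.ord r = n"
    using r n words word_of_A5_one_iff[of "r [^]\<^bsub>alt_group 5\<^esub> n"]
    by (intro A5.ord_eq_prime) (simp_all add: dihedral_words_def word_of_A5_one_iff word_of_A5_pow)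
  show "s \<notin> (\<lambda>i::nat. r [^]\<^bsub>alt_group 5\<^esub> i) ` {..<n}"
    using r words by (auto simp: dihedral_words_def list_all_iff word_of_A5_pow)
  show "s \<otimes>\<^bsub>alt_group 5\<^esub> s = \<one>\<^bsub>alt_group 5\<^esub>"
    using s words word_of_A5_one_iff[of "s \<otimes>\<^bsub>alt_group 5\<^esub> s"]
    by (simp add: dihedral_words_def word_of_A5_mult)
  show "(s \<otimes>\<^bsub>alt_group 5\<^esub> r) \<otimes>\<^bsub>alt_group 5\<^esub> (s \<otimes>\<^bsub>alt_group 5\<^esub> r) = \<one>\<^bsub>alt_group 5\<^esub>"
    using r s words word_of_A5_one_iff[of "(s \<otimes>\<^bsub>alt_group 5\<^esub> r) \<otimes>\<^bsub>alt_group 5\<^esub> (s \<otimes>\<^bsub>alt_group 5\<^esub> r)"]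
    by (simp add: dihedral_words_def word_of_A5_mult)
qed (use r s n in auto)

lemma A5_dihedral_subgroups:
  assumes "n \<in> {2, 3, 5}"
  obtains r s where "dihedral_pair (alt_group 5) r s n"
proof -
  have m: "transpose 1 2 \<circ> transpose 3 4 \<in> carrier (alt_group 5)"
      "transpose 1 3 \<circ> transpose 2 4 \<in> carrier (alt_group 5)"
      "transpose 1 2 \<circ> transpose 2 3 \<in> carrier (alt_group 5)"
      "transpose 1 2 \<circ> transpose 4 5 \<in> carrier (alt_group 5)"
      "transpose 3 4 \<circ> transpose 4 5 \<in> carrier (alt_group 5)"
      "transpose 2 5 \<circ> transpose 3 4 \<in> carrier (alt_group 5)"
    by (rule A5_double_transposition; simp)+
  \<comment> \<open>The pairs are two double transpositions of one Klein four-group; (1 2 3) with (1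
    2)(4 5); and (1 2 3 4 5), a product of two three-cycles, with its reflection fixing 1.\<close>
  have w: "dihedral_words (word_of (transpose 1 2 \<circ> transpose 3 4))
        (word_of (transpose 1 3 \<circ> transpose 2 4)) 2"
      "dihedral_words (word_of (transpose 1 2 \<circ> transpose 2 3))
        (word_of (transpose 1 2 \<circ> transpose 4 5)) 3"
      "dihedral_words (wcomp (word_of (transpose 1 2 \<circ> transpose 2 3))
        (word_of (transpose 3 4 \<circ> transpose 4 5))) (word_of (transpose 2 5 \<circ> transpose 3 4)) 5"
    by code_simp+
  show ?thesis
    using assms that A5_dihedral_pair[OF m(1,2) _ w(1)] A5_dihedral_pair[OF m(3,4) _ w(2)]
      A5_dihedral_pair[OF A5.m_closed[OF m(3,5)] m(6), of 5] w(3)[folded word_of_A5_mult[OF m(3,5)]]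
    by auto
qed

lemma hom_alt_group:
  assumes "h \<in> hom G (sym_group n)" "\<And>x. x \<in> carrier G \<Longrightarrow> sign (h x) = 1"
  shows "h \<in> hom G (alt_group n)"
proof -
  have "evenperm (h x)" if "x \<in> carrier G" for x
    using assms(2)[OF that] by (simp add: sign_def split: if_splits)
  then show ?thesis
    using assms(1) by (auto simp: hom_def alt_group_def sym_group_def)
qed

text \<open>Any \<open>s\<close> outside the cyclic subgroup works: \<open>s r\<close> lies outside
  as well, so both square to 1.\<close>

lemma (in group) dihedral_pair_of_involutions:
  assumes r: "r \<in> carrier G" "ord r = n" and n: "n > 0" and order: "order G = 2 * n"
    and sq: "\<And>x. x \<in> carrier G \<Longrightarrow> x \<notin> powers r \<Longrightarrow> x \<otimes> x = \<one>"
  obtains s where "dihedral_pair G r s n"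
proof -
  have "card (powers r) \<noteq> card (carrier G)"
    using card_powers[OF r(1)] r(2) n order by (simp add: order_def)
  then have "powers r \<noteq> carrier G"
    by metis
  moreover have "powers r \<subseteq> carrier G"
    using r(1) by (auto simp: powers_def)
  ultimately obtain s where s: "s \<in> carrier G" "s \<notin> powers r"
    by blast
  have "s \<otimes> r \<notin> powers r"
  proof
    assume "s \<otimes> r \<in> powers r"
    then obtain i where i: "s \<otimes> r = r [^] (i::nat)"
      by (auto simp: powers_def)
    have "s = s \<otimes> r [^] Suc (n - 1)"
      using r s(1) n pow_ord_eq_1[OF r(1)] by simp
    also have "\<dots> = (s \<otimes> r) \<otimes> r [^] (n - 1)"
      using r(1) s(1) nat_pow_Suc2[OF r(1), of "n - 1"] by (simp only: m_assoc nat_pow_closed)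
    also have "\<dots> = r [^] (i + (n - 1))"
      using i r(1) by (simp add: nat_pow_mult)
    finally have "s \<in> powers r"
      using pow_in_powers[of r "i + (n - 1)"] r n by simp
    then show False
      using s(2) by blast
  qed
  then have "dihedral_pair G r s n"
    using r s n sq by unfold_locales (auto simp: powers_def)
  then show ?thesis
    using that by blast
qed

context A5_basis_group
begin

text \<open>The sign is a homomorphism to {1, -1} and is trivial on odd orders. The count of
  involutions makes them one class, so they share one sign.\<close>

lemma inj_hom_alt_group:
  assumes h: "h \<in> hom G (sym_group n)" "inj_on h (carrier G)"
    and inv: "involutions 2 = {}" "4 * card (involutions 4) = order G"
  shows "\<exists>h\<in>hom G (alt_group n). inj_on h (carrier G)"
proof -
  interpret h: group_hom G "sym_group n" h
    using h(1) by (simp add: group_hom_def group_hom_axioms_def sym_group_is_group)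
  define e :: "'a \<Rightarrow> int" where "e x = sign (h x)" for x
  have e_mult: "e (x \<otimes> y) = e x * e y" if "x \<in> carrier G" "y \<in> carrier G" for x y
    using that sym_group_carrier'[of "h x" n] sym_group_carrier'[of "h y" n]
    by (simp add: e_def sym_group_mult sign_compose)
  have e_one: "e \<one> = 1"
    by (simp add: e_def sym_group_one)
  have e_pow: "e (x [^] (k::nat)) = e x ^ k" if "x \<in> carrier G" for x k
    by (induction k) (simp_all add: that e_one e_mult)
  have e_cases: "e x = 1 \<or> e x = -1" for x
    by (simp add: e_def sign_def)
  have e_conj: "e (g \<otimes> x \<otimes> inv g) = e x" if "g \<in> carrier G" "x \<in> carrier G" for g x
  proof -
    have "e g * e (inv g) = 1"
      using that(1) e_mult[of g "inv g"] e_one by simp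
    then show ?thesis
      using that by (simp add: e_mult algebra_simps)
  qed
  have "e x = 1" if x: "x \<in> carrier G" for x
  proof -
    have "x [^] (ord x) = \<one>"
      using x by (rule pow_ord_eq_1)
    then have pow: "e x ^ ord x = 1"
      using e_pow[OF x, of "ord x"] e_one by simp
    from ord_cases[OF x] consider "odd (ord x)" | "ord x = 2"
      by fastforce
    then show ?thesis
    proof cases
      case 1
      then show ?thesis
        using pow e_cases[of x] by auto
    next
      case 2
      have "x \<notin> involutions 2"
        using inv(1) by simp
      then have "card (cent x) \<noteq> 2"
        using 2 x by (simp add: involutions_def elements_def)
      then obtain s where s: "s \<in> carrier G" "ord s = 2" "ord (x \<otimes> s) = 2" "card (cent x) = 4"
        using cent_involution[OF x 2] by metis
      have x4: "x \<in> involutions 4"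
        using x 2 s(4) by (simp add: involutions_def elements_def)
      have "elements 2 = involutions 4"
        using elements_2 inv(1) by simp
      moreover have "involutions 4 = cls x"
        using finite_carrier conj_closed_involutions x4
        by (rule conj_closed_single_class) (use s(4) inv(2) in simp)
      \<comment> \<open>Thus \<open>x\<close>, \<open>s\<close> and \<open>x s\<close> have the same
        sign \<open>e\<close> with \<open>e = e * e\<close>.\<close>
      ultimately have "s \<in> cls x" "x \<otimes> s \<in> cls x"
        using s x by (auto simp: elements_def)
      then have "e s = e x" "e (x \<otimes> s) = e x"
        using x e_conj by (auto simp: cls_def)
      then have "e x = e x * e x"
        using e_mult[OF x s(1)] by simp
      then show ?thesis
        using e_cases[of x] by auto
    qed
  qed
  then have "h \<in> hom G (alt_group n)"
    using h(1) by (intro hom_alt_group) (simp_all add: e_def)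
  then show ?thesis
    using h(2) by blast
qed

section \<open>Embeddings, one order at a time\<close>

lemma exists_ord:
  assumes "order G \<noteq> 1"
  obtains x where "x \<in> carrier G" "x \<noteq> \<one>" "ord x \<in> {2, 3, 5}" "ord x dvd order G"
proof -
  have "carrier G \<noteq> {\<one>}"
    using assms by (auto simp: order_def)
  then obtain x where "x \<in> carrier G" "x \<noteq> \<one>"
    using one_closed by blast
  then show ?thesis
    using that ord_cases[of x] ord_dvd_group_order[of x] by blast
qed

lemma embedding_small:
  assumes "order G \<in> {1, 2, 3, 5}"
  shows "\<exists>h\<in>hom G (alt_group 5). inj_on h (carrier G)"
proof (cases "order G = 1")
  case True
  then show ?thesis
    using inj_hom_cyclic[of \<one> "alt_group 5" "\<one>\<^bsub>alt_group 5\<^esub>"] alt_group_is_group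
    by simp
next
  case False
  then obtain x where x: "x \<in> carrier G" "x \<noteq> \<one>" "ord x \<in> {2, 3, 5}" "ord x dvd order G"
    using exists_ord by blast
  then have ord: "ord x = order G"
    using assms False by auto
  \<comment> \<open>The rotation of a dihedral pair serves as the element of prescribed prime order
    in A_5.\<close>
  obtain r s where "dihedral_pair (alt_group 5) r s (ord x)"
    using A5_dihedral_subgroups x(3) by blast
  then interpret D: dihedral_pair "alt_group 5" r s "ord x" .
  show ?thesis
    using inj_hom_cyclic[OF x(1) ord _ alt_group_is_group D.r] D.ord_r ord assms by auto
qed

lemma embedding_dihedral:
  assumes p: "p \<in> {2, 3, 5}" and order: "order G = 2 * p"
    and r: "r \<in> carrier G" "ord r = p"
    and sq: "\<And>x. x \<in> carrier G \<Longrightarrow> x \<notin> powers r \<Longrightarrow> ord x = 2"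
  shows "\<exists>h\<in>hom G (alt_group 5). inj_on h (carrier G)"
proof -
  have "p > 0"
    using p by auto
  moreover have "x \<otimes> x = \<one>" if "x \<in> carrier G" "x \<notin> powers r" for x
    using sq[OF that] that(1) pow_ord_eq_1[of x] by (simp add: numeral_2_eq_2)
  ultimately obtain s where "dihedral_pair G r s p"
    using dihedral_pair_of_involutions[OF r] order by blast
  moreover obtain r' s' where "dihedral_pair (alt_group 5) r' s' p"
    using A5_dihedral_subgroups p by blast
  ultimately show ?thesis
    using dihedral_pair.inj_hom_dihedral[OF _ order] by metis
qed

text \<open>The \<open>p - 1\<close> elements of order \<open>p\<close> already fill one cyclic
  subgroup, so Lagrange leaves order 2 for everything outside it.\<close>

lemma embedding_2p:
  assumes p: "p \<in> {3, 5}" and order: "order G = 2 * p" and card: "card (elements p) = p - 1"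
  shows "\<exists>h\<in>hom G (alt_group 5). inj_on h (carrier G)"
proof -
  have "elements p \<noteq> {}"
    using card p by auto
  then obtain r where r: "r \<in> carrier G" "ord r = p"
    by (auto simp: elements_def)
  have one: "\<one> \<in> powers r"
    using pow_in_powers[of r 0] r p by auto
  have "powers r - {\<one>} \<subseteq> elements p"
  proof
    fix x assume x: "x \<in> powers r - {\<one>}"
    then have "x \<in> cent r"
      using powers_subset_cent[OF r(1)] by blast
    moreover have "r \<noteq> \<one>"
      using r p by auto
    ultimately show "x \<in> elements p"
      using in_cent_ord[of r x] r x by (simp add: elements_def cent_def)
  qed
  moreover have "card (powers r - {\<one>}) = p - 1"
    using one card_powers[OF r(1)] r(2) by simp
  ultimately have eq: "elements p = powers r - {\<one>}"
    using card finite_elements by (metis card_subset_eq)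
  have "ord x = 2" if x: "x \<in> carrier G" "x \<notin> powers r" for x
  proof -
    have "ord x \<noteq> p" "x \<noteq> \<one>"
      using x eq one by (auto simp: elements_def)
    moreover have "ord x dvd 2 * p"
      using ord_dvd_group_order[OF x(1)] order by simp
    ultimately show ?thesis
      using ord_cases[OF x(1)] p by auto
  qed
  then show ?thesis
    using embedding_dihedral[of p r] p order r by auto
qed

text \<open>By Lagrange every non-trivial element has order 2, so this is the dihedral case with
  \<open>n = 2\<close>.\<close>

lemma embedding_4:
  assumes order: "order G = 4"
  shows "\<exists>h\<in>hom G (alt_group 5). inj_on h (carrier G)"
proof -
  have ord2: "ord x = 2" if "x \<in> carrier G" "x \<noteq> \<one>" for x
    using ord_cases[OF that(1)] ord_dvd_group_order[OF that(1)] that(2) order by auto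
  obtain r where r: "r \<in> carrier G" "r \<noteq> \<one>"
    using exists_ord order by auto
  have "\<one> \<in> powers r"
    using pow_in_powers[of r 0] r ord2[OF r] by simp
  then show ?thesis
    using embedding_dihedral[of 2 r] order r ord2 by auto
qed

text \<open>Supplies the smallness hypothesis of \<open>trivial_kernel\<close>: orders 2, 3, 5 have
  centralizers of size at most 4, 3, 5.\<close>

lemma small_cent:
  assumes "z \<in> carrier G" "z \<noteq> \<one>" "ord z = 2 \<or> ord z = 3 \<Longrightarrow> k \<ge> 4" "ord z = 5 \<Longrightarrow> k \<ge> 5"
  shows "card (cent z) \<le> k"
proof -
  have "card (cent z) \<le> 4" if "ord z = 2"
  proof -
    have "z \<in> elements 2"
      using that assms(1) by (simp add: elements_def)
    then show ?thesis
      unfolding elements_2 by (auto simp: involutions_def)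
  qed
  then show ?thesis
    using ord_cases[OF assms(1)] assms card_cent_odd[OF assms(1)] by fastforce
qed

text \<open>A class of elements of order 3 has 12 / 3 = 4 members. With no elements of order 5,
  non-trivial elements have centralizers of size at most 4, so the action is faithful.\<close>

lemma embedding_12:
  assumes order: "order G = 12" and "elements 3 \<noteq> {}" "elements 5 = {}"
    and inv: "involutions 2 = {}" "card (involutions 4) = 3"
  shows "\<exists>h\<in>hom G (alt_group 5). inj_on h (carrier G)"
proof -
  obtain y where y: "y \<in> carrier G" "ord y = 3"
    using assms(2) by (auto simp: elements_def)
  interpret act: group_action G "carrier G" "\<lambda>g. \<lambda>h\<in>carrier G. g \<otimes> h \<otimes> inv g"
    by (rule action_by_conjugation)
  let ?orbit = "orbit G (\<lambda>g. \<lambda>h\<in>carrier G. g \<otimes> h \<otimes> inv g) y"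
  have card: "card ?orbit = 4"
    using card_cls[OF y(1)] card_cent_odd[OF y(1)] y order by (simp add: orbit_conj)
  have small: "card (cent z) \<le> card ?orbit" if "z \<in> carrier G" "z \<noteq> \<one>" for z
    unfolding card using small_cent[OF that, of 4] assms(3) that(1) by (auto simp: elements_def)
  have "\<exists>h\<in>hom G (sym_group 5). inj_on h (carrier G)"
    using finite_carrier y(1)
    by (rule act.inj_hom_orbit) (use card act.trivial_kernel[OF finite_carrier y(1) small] in auto)
  then show ?thesis
    using inj_hom_alt_group inv order by auto
qed

text \<open>The centralizers of the 15 involutions are five Klein four-groups, any two of which meet
  trivially; they are permuted by conjugation.\<close>

lemma embedding_60:
  assumes order: "order G = 60" and inv: "involutions 2 = {}" "card (involutions 4) = 15"
  shows "\<exists>h\<in>hom G (alt_group 5). inj_on h (carrier G)"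
proof -
  have inv_4: "elements 2 = involutions 4"
    using elements_2 inv(1) by simp
  have "involutions 4 \<noteq> {}"
    using inv(2) by auto
  then obtain t where t: "t \<in> involutions 4"
    by blast
  then have tG: "t \<in> carrier G"
    by (simp add: involutions_def elements_def)
  have cls: "involutions 4 = cls t"
    using finite_carrier conj_closed_involutions t
    by (rule conj_closed_single_class) (use t inv(2) order in \<open>simp add: involutions_def\<close>)
  let ?E = "{H. H \<subseteq> carrier G}"
  let ?conj = "\<lambda>g. \<lambda>H\<in>?E. g <# H #> inv g"
  interpret act: group_action G ?E ?conj
    by (rule action_by_conjugation_on_power_set)
  have E: "cent t \<in> ?E"
    by (auto simp: cent_def)
  have orbit: "orbit G ?conj (cent t) = cent ` involutions 4"
  proof -
    have "orbit G ?conj (cent t) = (\<lambda>g. ?conj g (cent t)) ` carrier G"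
      by (auto simp: orbit_def)
    also have "\<dots> = (\<lambda>g. cent (g \<otimes> t \<otimes> inv g)) ` carrier G"
      by (rule image_cong) (use E tG in \<open>simp_all add: conj_cent\<close>)
    finally show ?thesis
      by (simp add: cls cls_def image_image)
  qed
  have klein: "card (cent s) = 4 \<and> \<one> \<in> cent s \<and> cent s - {\<one>} \<subseteq> involutions 4 \<and>
      (\<forall>u\<in>cent s - {\<one>}. cent u = cent s)" if s: "s \<in> involutions 4" for s
  proof -
    have sG: "s \<in> carrier G" "ord s = 2" and card: "card (cent s) = 4"
      using s by (simp_all add: involutions_def elements_def)
    then have "s \<noteq> \<one>"
      by auto
    have u: "u \<in> involutions 4 \<and> cent u = cent s" if "u \<in> cent s - {\<one>}" for u
    proof -
      have "u \<in> carrier G"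
        using that by (simp add: cent_def)
      then have u4: "u \<in> involutions 4"
        using in_cent_ord[OF sG(1) \<open>s \<noteq> \<one>\<close>, of u] that sG(2) inv_4 by (auto simp: elements_def)
      \<comment> \<open>The centralizer of an involution is abelian, and equal cardinality turns the
        inclusion into equality.\<close>
      have "cent s \<subseteq> cent u"
        using cent_involution_commute[OF sG] that by (auto simp: cent_def)
      moreover have "card (cent u) = card (cent s)" "finite (cent u)"
        using u4 card finite_carrier by (simp_all add: involutions_def cent_def)
      ultimately show ?thesis
        using u4 card_subset_eq by metis
    qed
    then show ?thesis
      using card sG(1) by (auto simp: cent_def[of s])
  qed
  \<comment> \<open>Without the identity the four-groups become disjoint blocks of three
    involutions, and 15 = 3 * 5 counts them.\<close>
  let ?P = "(\<lambda>H. H - {\<one>}) ` cent ` involutions 4"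
  have "inj_on (\<lambda>H. H - {\<one>}) (cent ` involutions 4)"
    using klein by (intro inj_onI) (metis imageE insert_Diff)
  then have "card ?P = card (cent ` involutions 4)"
    by (rule card_image)
  moreover have "\<Union> ?P = involutions 4"
  proof
    have "s \<in> cent s - {\<one>}" if "s \<in> involutions 4" for s
      using that by (auto simp: involutions_def elements_def cent_def)
    then show "involutions 4 \<subseteq> \<Union> ?P"
      by blast
  qed (use klein in blast)
  moreover have "3 * card ?P = card (\<Union> ?P)"
  proof (rule card_partition)
    have fin: "finite (involutions 4)"
      using finite_elements inv_4 by metis
    then show "finite ?P"
      by simp
    show "finite (\<Union> ?P)"
      using fin \<open>\<Union> ?P = involutions 4\<close> by simp
    show "card H = 3" if H: "H \<in> ?P" for H
    proof -
      obtain s where "s \<in> involutions 4" "H = cent s - {\<one>}"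
        using H by blast
      moreover from this have "card (cent s) = 4" "\<one> \<in> cent s"
        using klein[of s] by blast+
      ultimately show ?thesis
        by simp
    qed
    show "H \<inter> K = {}" if HK: "H \<in> ?P" "K \<in> ?P" "H \<noteq> K" for H K
    proof (rule ccontr)
      assume "H \<inter> K \<noteq> {}"
      then obtain u where u: "u \<in> H" "u \<in> K"
        by blast
      obtain s s' where s: "s \<in> involutions 4" "H = cent s - {\<one>}"
        and s': "s' \<in> involutions 4" "K = cent s' - {\<one>}"
        using HK by blast
      have "cent u = cent s" "cent u = cent s'"
        using klein[OF s(1)] klein[OF s'(1)] u s(2) s'(2) by blast+
      then show False
        using HK(3) s(2) s'(2) by simp
    qed
  qed
  ultimately have card: "card (orbit G ?conj (cent t)) = 5"
    using inv(2) orbit by simp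
  have small: "card (cent z) \<le> card (orbit G ?conj (cent t))" if "z \<in> carrier G" "z \<noteq> \<one>" for z
    unfolding card using small_cent[OF that, of 5] by simp
  have "\<exists>h\<in>hom G (sym_group 5). inj_on h (carrier G)"
    using finite_carrier E
    by (rule act.inj_hom_orbit) (use card act.trivial_kernel[OF finite_carrier E small] in auto)
  then show ?thesis
    using inj_hom_alt_group inv order by auto
qed

lemma is_section_of_A5: "is_section_of G (alt_group 5)"
proof -
  have "\<exists>h\<in>hom G (alt_group 5). inj_on h (carrier G)"
  proof (cases rule: order_cases)
    case 1
    then show ?thesis
      using embedding_small embedding_4 by auto
  next
    case 2
    then show ?thesis
      using embedding_2p[of 3] by simp
  next
    case 3
    then show ?thesis
      using embedding_2p[of 5] by simp
  next
    case 4
    then show ?thesis by (rule embedding_12)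
  next
    case 5
    then show ?thesis by (rule embedding_60)
  qed
  then show ?thesis
    using is_section_of_inj_hom[OF is_group alt_group_is_group] by blast
qed

end

theorem theorem1:
  fixes G :: "('a, 'b) monoid_scheme"
  shows "A5_basis (alt_group 5) \<and> (group G \<and> A5_basis G \<longrightarrow> is_section_of G (alt_group 5))"
  using A5_basis_A5 A5_basis_group.is_section_of_A5[of G]
  by (simp add: A5_basis_group_def A5_basis_group_axioms_def)

end
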